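(* Let $\mathcal L$ be a finite relational language and let $M$ be a countable $\mathcal L$-structure that is mutually algebraic but not cellular. Then there is an elementary extension $M^*\succ M$ containing infinitely many new (i.e., disjoint from $M$) infinite MA-connected components, pairwise isomorphic over $M$. Furthermore, $M^*$ may be taken to have universe equal to the universe of $M$ together with these new components.
   Context: For a structure $M$, an $n$-ary relation $R\subseteq M^n$ is mutually algebraic if there is $K$ such that each $m\in M$ occurs in at most $K$ tuples of $R$; a formula is mutually algebraic if the relation it defines is. $M$ is mutually algebraic if every formula with parameters from $M$ is equivalent in $M$ to a boolean combination of mutually algebraic formulas with parameters from $M$. A structure is MA-presented if every atomic formula of its language is mutually algebraic. In an MA-presented structure $N$, $b$ is a mate of $a$ if some atomic formula holds of some tuple (in some order) containing both $a$ and $b$; $\sim$ is the transitive closure of the mate relation, and its classes are called MA-connected components. Since $M$ is mutually algebraic, every atomic $\mathcal L$-formula is equivalent in $M$ to a boolean combination of quantifier-free mutually algebraic formulas with parameters from $M$; fix a finite set $\mathcal A$ of such quantifier-free mutually algebraic formulas $\phi(\bar x,\bar a)$ witnessing this. For any $N\succeq M$, let $N_{\mathcal A}$ be the structure with universe $N$ in the language consisting of a constant for each parameter occurring in $\mathcal A$ and a relation $R_\phi$ interpreted as $\phi(N,\bar a)$ for each $\phi(\bar x,\bar a)\in\mathcal A$; $N_{\mathcal A}$ is MA-presented, and the MA-connected components of $N$ are understood as the $\sim$-classes of $N_{\mathcal A}$. Components $C,C'$ are isomorphic over $M$ if there is a bijection $C\to C'$ which together with the identity on $M$ is an isomorphism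 of the induced substructures on $M\cup C$ and $M\cup C'$. Cellular: $M$ admits a partition $\{K\}\cup\{\bar c_{i,j}:i\in[n],j\in\omega\}$ with $K$ finite, $\bar c_{i,j}$ of length $k_i$, tuples with the same $i$ pairwise isomorphic over $K$, and for every $i$ and permutation $\sigma$ of $\omega$ an automorphism of $M$ sending $\bar c_{i,j}$ coordinatewise to $\bar c_{i,\sigma(j)}$ and fixing everything outside $\bigcup_j\bar c_{i,j}$ pointwise. *)

theory Defs
  imports Complex_Main "HOL-Library.Countable_Set"
begin

section \<open>First-order logic over relational languages with named constants\<close>

text \<open>
  The symbols of a relational language are the members of \<open>rels L\<close>. Constant symbols are kept
  separate: formulas may mention constants of type \<open>'c\<close>, and a map \<open>\<kappa> :: 'c \<Rightarrow> 'a\<close>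
  interprets them. Formulas with parameters from \<open>M\<close> are obtained by taking the elements of \<open>M\<close>
  themselves as constants, with \<open>\<kappa> = id\<close>.
\<close>

record 'r lang =
  rels :: "'r set"
  arity :: "'r \<Rightarrow> nat"

record ('r, 'a) struct =
  univ :: "'a set"
  rel :: "'r \<Rightarrow> 'a list set"

definition is_struct :: "'r lang \<Rightarrow> ('r, 'a) struct \<Rightarrow> bool" where
  "is_struct L M \<longleftrightarrow> univ M \<noteq> {} \<and>
     (\<forall>r\<in>rels L. \<forall>t\<in>rel M r. length t = arity L r \<and> set t \<subseteq> univ M)"

datatype (tm_consts: 'c) tm = Var nat | Cst 'c

datatype (fm_rels: 'r, fm_consts: 'c) fm =
    Falsum
  | Rel 'r "'c tm list"
  | Eq "'c tm" "'c tm"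
  | Neg "('r, 'c) fm"
  | And "('r, 'c) fm" "('r, 'c) fm"
  | Ex nat "('r, 'c) fm"

primrec tm_vars :: "'c tm \<Rightarrow> nat set" where
  "tm_vars (Var v) = {v}"
| "tm_vars (Cst c) = {}"

primrec fv :: "('r, 'c) fm \<Rightarrow> nat set" where
  "fv Falsum = {}"
| "fv (Rel r ts) = (\<Union>t\<in>set ts. tm_vars t)"
| "fv (Eq s t) = tm_vars s \<union> tm_vars t"
| "fv (Neg \<phi>) = fv \<phi>"
| "fv (And \<phi> \<psi>) = fv \<phi> \<union> fv \<psi>"
| "fv (Ex v \<phi>) = fv \<phi> - {v}"

primrec qfree :: "('r, 'c) fm \<Rightarrow> bool" where
  "qfree Falsum = True"
| "qfree (Rel r ts) = True"
| "qfree (Eq s t) = True"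
| "qfree (Neg \<phi>) = qfree \<phi>"
| "qfree (And \<phi> \<psi>) = (qfree \<phi> \<and> qfree \<psi>)"
| "qfree (Ex v \<phi>) = False"

primrec well_formed :: "'r lang \<Rightarrow> ('r, 'c) fm \<Rightarrow> bool" where
  "well_formed L Falsum = True"
| "well_formed L (Rel r ts) = (r \<in> rels L \<and> length ts = arity L r)"
| "well_formed L (Eq s t) = True"
| "well_formed L (Neg \<phi>) = well_formed L \<phi>"
| "well_formed L (And \<phi> \<psi>) = (well_formed L \<phi> \<and> well_formed L \<psi>)"
| "well_formed L (Ex v \<phi>) = well_formed L \<phi>"

definition formulas :: "'r lang \<Rightarrow> 'c set \<Rightarrow> ('r, 'c) fm set" where
  "formulas L C = {\<phi>. well_formed L \<phi> \<and> fm_consts \<phi> \<subseteq> C}"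

definition atomic_formulas :: "'r lang \<Rightarrow> 'c set \<Rightarrow> ('r, 'c) fm set" where
  "atomic_formulas L C =
     {\<phi> \<in> formulas L C. (\<exists>r ts. \<phi> = Rel r ts) \<or> (\<exists>s t. \<phi> = Eq s t)}"

primrec tm_val :: "('c \<Rightarrow> 'a) \<Rightarrow> (nat \<Rightarrow> 'a) \<Rightarrow> 'c tm \<Rightarrow> 'a" where
  "tm_val \<kappa> e (Var v) = e v"
| "tm_val \<kappa> e (Cst c) = \<kappa> c"

primrec sat :: "('r, 'a) struct \<Rightarrow> ('c \<Rightarrow> 'a) \<Rightarrow> (nat \<Rightarrow> 'a) \<Rightarrow> ('r, 'c) fm \<Rightarrow> bool" where
  "sat M \<kappa> e Falsum = False"
| "sat M \<kappa> e (Rel r ts) = (map (tm_val \<kappa> e) ts \<in> rel M r)"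
| "sat M \<kappa> e (Eq s t) = (tm_val \<kappa> e s = tm_val \<kappa> e t)"
| "sat M \<kappa> e (Neg \<phi>) = (\<not> sat M \<kappa> e \<phi>)"
| "sat M \<kappa> e (And \<phi> \<psi>) = (sat M \<kappa> e \<phi> \<and> sat M \<kappa> e \<psi>)"
| "sat M \<kappa> e (Ex v \<phi>) = (\<exists>x\<in>univ M. sat M \<kappa> (e(v := x)) \<phi>)"

definition equivalent_in ::
    "('r, 'a) struct \<Rightarrow> ('c \<Rightarrow> 'a) \<Rightarrow> ('r, 'c) fm \<Rightarrow> ('r, 'c) fm \<Rightarrow> bool" where
  "equivalent_in M \<kappa> \<phi> \<psi> \<longleftrightarrow>
     (\<forall>e. range e \<subseteq> univ M \<longrightarrow> (sat M \<kappa> e \<phi> \<longleftrightarrow> sat M \<kappa> e \<psi>))"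

inductive_set bool_combs :: "('r, 'c) fm set \<Rightarrow> ('r, 'c) fm set" for S where
  "\<phi> \<in> S \<Longrightarrow> \<phi> \<in> bool_combs S"
| "Falsum \<in> bool_combs S"
| "\<phi> \<in> bool_combs S \<Longrightarrow> Neg \<phi> \<in> bool_combs S"
| "\<phi> \<in> bool_combs S \<Longrightarrow> \<psi> \<in> bool_combs S \<Longrightarrow> And \<phi> \<psi> \<in> bool_combs S"

text \<open>
  \<open>defined_rel M \<kappa> \<phi>\<close> is \<open>\<phi>(M)\<close>, the tuple of variables being exactly the free variables of
  \<open>\<phi>\<close> (in increasing order); dummy variables are not allowed.
\<close>

definition defined_rel :: "('r, 'a) struct \<Rightarrow> ('c \<Rightarrow> 'a) \<Rightarrow> ('r, 'c) fm \<Rightarrow> 'a list set" where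
  "defined_rel M \<kappa> \<phi> =
     {map e (sorted_list_of_set (fv \<phi>)) | e. range e \<subseteq> univ M \<and> sat M \<kappa> e \<phi>}"

text \<open>
  \<open>N\<close> is an elementary extension of \<open>M\<close>, where \<open>M\<close> is identified with its image under \<open>\<iota>\<close>.
  The map \<open>\<iota>\<close> is needed because \<open>M\<close> may exhaust its type.
\<close>

definition elementary_extension ::
    "'r lang \<Rightarrow> ('r, 'a) struct \<Rightarrow> ('a \<Rightarrow> 'b) \<Rightarrow> ('r, 'b) struct \<Rightarrow> bool" where
  "elementary_extension L M \<iota> N \<longleftrightarrow>
     is_struct L N \<and> inj_on \<iota> (univ M) \<and> \<iota> ` univ M \<subseteq> univ N \<and>
     (\<forall>\<phi>\<in>formulas L (univ M). \<forall>e. range e \<subseteq> univ M \<longrightarrow>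
        (sat M id e \<phi> \<longleftrightarrow> sat N \<iota> (\<iota> \<circ> e) \<phi>))"


section \<open>Isomorphisms and cellularity\<close>

definition induced :: "('r, 'a) struct \<Rightarrow> 'a set \<Rightarrow> ('r, 'a) struct" where
  "induced M S = \<lparr>univ = univ M \<inter> S, rel = (\<lambda>r. {t \<in> rel M r. set t \<subseteq> S})\<rparr>"

definition isomorphism ::
    "'r lang \<Rightarrow> ('a \<Rightarrow> 'b) \<Rightarrow> ('r, 'a) struct \<Rightarrow> ('r, 'b) struct \<Rightarrow> bool" where
  "isomorphism L f M N \<longleftrightarrow> bij_betw f (univ M) (univ N) \<and>
     (\<forall>r\<in>rels L. \<forall>t. length t = arity L r \<and> set t \<subseteq> univ M \<longrightarrow>
        (t \<in> rel M r \<longleftrightarrow> map f t \<in> rel N r))"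

definition isomorphic_over ::
    "'r lang \<Rightarrow> ('r, 'a) struct \<Rightarrow> 'a set \<Rightarrow> 'a set \<Rightarrow> 'a set \<Rightarrow> bool" where
  "isomorphic_over L N B C C' \<longleftrightarrow>
     (\<exists>f. bij_betw f C C' \<and> (\<forall>b\<in>B. f b = b) \<and>
          isomorphism L f (induced N (B \<union> C)) (induced N (B \<union> C')))"

definition cellular :: "'r lang \<Rightarrow> ('r, 'a) struct \<Rightarrow> bool" where
  "cellular L M \<longleftrightarrow>
     (\<exists>(K :: 'a set) (n :: nat) (k :: nat \<Rightarrow> nat) (c :: nat \<Rightarrow> nat \<Rightarrow> 'a list).
        finite K \<and>
        univ M = K \<union> (\<Union>i<n. \<Union>j. set (c i j)) \<and>
        (\<forall>i<n. 0 < k i) \<and>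
        (\<forall>i<n. \<forall>j. length (c i j) = k i \<and> distinct (c i j) \<and> set (c i j) \<inter> K = {}) \<and>
        (\<forall>i<n. \<forall>i'<n. \<forall>j j'. (i, j) \<noteq> (i', j') \<longrightarrow> set (c i j) \<inter> set (c i' j') = {}) \<and>
        (\<forall>i<n. \<forall>j j'. \<exists>f. (\<forall>x\<in>K. f x = x) \<and> map f (c i j) = c i j' \<and>
           isomorphism L f (induced M (K \<union> set (c i j))) (induced M (K \<union> set (c i j')))) \<and>
        (\<forall>i<n. \<forall>\<sigma> :: nat \<Rightarrow> nat. bij \<sigma> \<longrightarrow>
           (\<exists>f. isomorphism L f M M \<and> (\<forall>j. map f (c i j) = c i (\<sigma> j)) \<and>
                (\<forall>x \<in> univ M - (\<Union>j. set (c i j)). f x = x))))"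


section \<open>Mutual algebraicity\<close>

definition mutually_algebraic_rel :: "'a set \<Rightarrow> 'a list set \<Rightarrow> bool" where
  "mutually_algebraic_rel U R \<longleftrightarrow>
     (\<exists>K :: nat. \<forall>m\<in>U. finite {t \<in> R. m \<in> set t} \<and> card {t \<in> R. m \<in> set t} \<le> K)"

definition mutually_algebraic_formula ::
    "('r, 'a) struct \<Rightarrow> ('c \<Rightarrow> 'a) \<Rightarrow> ('r, 'c) fm \<Rightarrow> bool" where
  "mutually_algebraic_formula M \<kappa> \<phi> \<longleftrightarrow> mutually_algebraic_rel (univ M) (defined_rel M \<kappa> \<phi>)"

definition mutually_algebraic :: "'r lang \<Rightarrow> ('r, 'a) struct \<Rightarrow> bool" where
  "mutually_algebraic L M \<longleftrightarrow>
     (\<forall>\<phi>\<in>formulas L (univ M).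
        \<exists>\<psi>\<in>bool_combs {\<theta> \<in> formulas L (univ M). mutually_algebraic_formula M id \<theta>}.
          equivalent_in M id \<phi> \<psi>)"

text \<open>
  Two elements are mates if they occur in a common tuple satisfying an atomic formula. The atomic
  formula \<open>x = y\<close> makes the relation reflexive, so its transitive closure is an
  equivalence relation on the universe.
\<close>

definition mates ::
    "'r lang \<Rightarrow> 'c set \<Rightarrow> ('r, 'a) struct \<Rightarrow> ('c \<Rightarrow> 'a) \<Rightarrow> ('a \<times> 'a) set" where
  "mates L C N \<kappa> =
     {(a, b). \<exists>\<alpha>\<in>atomic_formulas L C. \<exists>t\<in>defined_rel N \<kappa> \<alpha>. a \<in> set t \<and> b \<in> set t}"

definition MA_components ::
    "'r lang \<Rightarrow> 'c set \<Rightarrow> ('r, 'a) struct \<Rightarrow> ('c \<Rightarrow> 'a) \<Rightarrow> 'a set set" where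
  "MA_components L C N \<kappa> = univ N // (mates L C N \<kappa>)\<^sup>+"


section \<open>The MA-presented structure attached to a finite set of formulas\<close>

primrec rename_tm :: "(nat \<Rightarrow> nat) \<Rightarrow> 'c tm \<Rightarrow> 'c tm" where
  "rename_tm f (Var v) = Var (f v)"
| "rename_tm f (Cst c) = Cst c"

text \<open>Only applied to quantifier-free formulas, so variable capture is not an issue.\<close>

primrec rename_vars :: "(nat \<Rightarrow> nat) \<Rightarrow> ('r, 'c) fm \<Rightarrow> ('r, 'c) fm" where
  "rename_vars f Falsum = Falsum"
| "rename_vars f (Rel r ts) = Rel r (map (rename_tm f) ts)"
| "rename_vars f (Eq s t) = Eq (rename_tm f s) (rename_tm f t)"
| "rename_vars f (Neg \<phi>) = Neg (rename_vars f \<phi>)"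
| "rename_vars f (And \<phi> \<psi>) = And (rename_vars f \<phi>) (rename_vars f \<psi>)"
| "rename_vars f (Ex v \<phi>) = Ex v (rename_vars (f(v := v)) \<phi>)"

text \<open>
  \<open>A\<close> is a finite set of quantifier-free mutually algebraic formulas with parameters from \<open>M\<close>
  such that every atomic formula of \<open>L\<close> is, in \<open>M\<close>, a boolean combination of formulas
  \<open>\<phi>(z\<^sub>1, \<dots>, z\<^sub>m)\<close> with \<open>\<phi> \<in> A\<close>. Since \<open>A\<close> is finite while the variables are not, its members
  can only witness this up to a choice of variables. Equality is a logical symbol and may
  always be used in the combination, whether or not \<open>A\<close> lists it.
\<close>

definition MA_basis :: "'r lang \<Rightarrow> ('r, 'a) struct \<Rightarrow> ('r, 'a) fm set \<Rightarrow> bool" where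
  "MA_basis L M A \<longleftrightarrow>
     finite A \<and>
     (\<forall>\<phi>\<in>A. \<phi> \<in> formulas L (univ M) \<and> qfree \<phi> \<and> mutually_algebraic_formula M id \<phi>) \<and>
     (\<forall>\<alpha>\<in>atomic_formulas L {}.
        \<exists>\<psi>\<in>bool_combs ({rename_vars f \<phi> | f \<phi>. \<phi> \<in> A} \<union> {Eq (Var i) (Var j) | i j. True}).
          equivalent_in M id \<alpha> \<psi>)"

text \<open>
  The structure \<open>N\<^sub>A\<close>: the relation symbol \<open>R\<^sub>\<phi>\<close> is represented by \<open>\<phi>\<close> itself, and the
  constants for the parameters occurring in \<open>A\<close> are interpreted by \<open>\<iota>\<close>, the
  inclusion of the smaller structure in \<open>N\<close>.
\<close>

definition basis_lang :: "('r, 'a) fm set \<Rightarrow> ('r, 'a) fm lang" where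
  "basis_lang A = \<lparr>rels = A, arity = (\<lambda>\<phi>. card (fv \<phi>))\<rparr>"

definition basis_consts :: "('r, 'a) fm set \<Rightarrow> 'a set" where
  "basis_consts A = (\<Union>\<phi>\<in>A. fm_consts \<phi>)"

definition basis_struct ::
    "('r, 'b) struct \<Rightarrow> ('a \<Rightarrow> 'b) \<Rightarrow> ('r, 'a) fm set \<Rightarrow> (('r, 'a) fm, 'b) struct" where
  "basis_struct N \<iota> A =
     \<lparr>univ = univ N, rel = (\<lambda>\<phi>. if \<phi> \<in> A then defined_rel N \<iota> \<phi> else {})\<rparr>"

definition components_over ::
    "('r, 'b) struct \<Rightarrow> ('a \<Rightarrow> 'b) \<Rightarrow> ('r, 'a) fm set \<Rightarrow> 'b set set" where
  "components_over N \<iota> A =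
     MA_components (basis_lang A) (basis_consts A) (basis_struct N \<iota> A) \<iota>"

end

theory Submission
  imports Defs "HOL-Library.Diagonal_Subsequence"
begin

text \<open>
  The formulas of \<open>A\<close> turn \<open>M\<close> into a structure of bounded degree whose quantifier-free types
  determine those of \<open>M\<close>. If its components had bounded size, only finitely many isomorphism types
  of components would occur, and permuting isomorphic components would make \<open>M\<close> cellular. So there
  are distinct points \<open>p n\<close> in components of size at least \<open>n\<close>; after passing to a subsequence all
  their finite neighbourhoods converge, and the limit is an infinite component \<open>C\<close> each of whose
  finite neighbourhoods is also the neighbourhood of infinitely many points of \<open>M\<close>. Adding
  infinitely many disjoint copies of \<open>C\<close> to \<open>M\<close> gives an elementary extension by Hanf locality:
  in the Ehrenfeucht--Fraisse game, once the finitely many points whose neighbourhood type occurs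
  only finitely often are named, a move far away from all earlier points can always be answered
  inside \<open>M\<close>.
\<close>

section \<open>Structures of bounded degree\<close>

text \<open>Compactness would leave elements of unknown origin, while the universe must be exactly
  \<open>M\<close> and the copies; hence the hand-made limit. There the relations indexed by
  \<open>A\<close> come first and the \<open>L\<close>-relations are derived from them. That a
  formula of \<open>A\<close>, evaluated in the extension, gives back its prescribed relation must
  then be proved, and this is what identifies the components. Each quantifier turns a radius r into
  3r + 1. A move within 2r + 1 of earlier points is copied along a word, and its r-ball lies within
  (2r + 1) + r of them. A tuple joining two r-balls puts their centres within r + 1 + r of each
  other, so beyond 2r + 1 the balls do not interact, and the answer only needs the right r-ball and
  the same remoteness. Remoteness excludes finitely many candidates, hence the demand for infinitely
  many; a point without them is paired with itself from the start, so that it is never far.\<close>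

text \<open>
  The mates of \<open>x\<close> are enumerated, possibly with repetitions, by \<open>nbr k x\<close> for \<open>k < D\<close>. A word
  over \<open>{..<D}\<close> then describes a walk starting at any given point, and neighbourhoods can be compared
  along equal words without choosing isomorphisms.
\<close>

locale labelled_structure =
  fixes U :: "'a set" and I :: "'i set" and ar :: "'i \<Rightarrow> nat" and R :: "'i \<Rightarrow> 'a list set"
    and eq :: 'i and D :: nat and nbr :: "nat \<Rightarrow> 'a \<Rightarrow> 'a"
  assumes finite_I: "finite I"
    and R_tuple: "i \<in> I \<Longrightarrow> t \<in> R i \<Longrightarrow> length t = ar i \<and> set t \<subseteq> U"
    and eq_in: "eq \<in> I"
    and R_eq: "R eq = {[x, x] | x. x \<in> U}"
    and nbr_onto: "i \<in> I \<Longrightarrow> t \<in> R i \<Longrightarrow> x \<in> set t \<Longrightarrow> y \<in> set t \<Longrightarrow> \<exists>k<D. nbr k x = y"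
    and nbr_mate: "x \<in> U \<Longrightarrow> k < D \<Longrightarrow> \<exists>i\<in>I. \<exists>t\<in>R i. x \<in> set t \<and> nbr k x \<in> set t"
begin

definition words :: "nat \<Rightarrow> nat list set" where
  "words r = {w. set w \<subseteq> {..<D} \<and> length w \<le> r}"

text \<open>
  Because \<open>eq\<close> is among the relations, \<open>pres P\<close> forces \<open>P\<close> to be the graph of a partial isomorphism.
\<close>

definition pres :: "('a \<times> 'a) set \<Rightarrow> bool" where
  "pres P \<longleftrightarrow> (\<forall>i\<in>I. \<forall>s t. list_all2 (\<lambda>a b. (a, b) \<in> P) s t \<longrightarrow> (s \<in> R i \<longleftrightarrow> t \<in> R i))"

text \<open>The correspondence of r-balls that \<open>P\<close> ought to induce: both ends follow
  the same word. It need not be single-valued; on \<open>U\<close> this is part of what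
  \<open>pres (spread r P)\<close> demands.\<close>

definition spread :: "nat \<Rightarrow> ('a \<times> 'a) set \<Rightarrow> ('a \<times> 'a) set" where
  "spread r P = {(fold nbr w a, fold nbr w b) | w a b. w \<in> words r \<and> (a, b) \<in> P}"

definition comp :: "'a \<Rightarrow> 'a set" where
  "comp x = {fold nbr w x | w. set w \<subseteq> {..<D}}"

section \<open>Walks and connected components\<close>

lemma finite_words [simp]: "finite (words r)"
  unfolding words_def by (rule finite_lists_length_le) simp

lemma nbr_in_U: "x \<in> U \<Longrightarrow> k < D \<Longrightarrow> nbr k x \<in> U"
  using nbr_mate R_tuple by blast

lemma nbr_sym: "x \<in> U \<Longrightarrow> k < D \<Longrightarrow> \<exists>l<D. nbr l (nbr k x) = x"
  using nbr_mate nbr_onto by metis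

lemma walk_in_U: "x \<in> U \<Longrightarrow> set w \<subseteq> {..<D} \<Longrightarrow> fold nbr w x \<in> U"
  by (induction w arbitrary: x) (auto simp: nbr_in_U)

text \<open>Mates are symmetric, so each step can be undone, but by a label unrelated to the
  original one. Only the length survives, and the radius estimates use nothing else.\<close>

lemma walk_back:
  "x \<in> U \<Longrightarrow> set w \<subseteq> {..<D} \<Longrightarrow>
    \<exists>v. set v \<subseteq> {..<D} \<and> length v = length w \<and> fold nbr v (fold nbr w x) = x"
proof (induction w arbitrary: x)
  case Nil
  then show ?case by simp
next
  case (Cons k w)
  then obtain v where v: "set v \<subseteq> {..<D}" "length v = length w"
      "fold nbr v (fold nbr w (nbr k x)) = nbr k x"
    using nbr_in_U[of x k] by (metis insert_subset lessThan_iff list.simps(15))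
  obtain l where l: "l < D" "nbr l (nbr k x) = x"
    using nbr_sym[of x k] Cons.prems by auto
  show ?case
    using v l by (intro exI[of _ "v @ [l]"]) auto
qed

text \<open>Walk from \<open>y\<close> along \<open>v\<close> into the tuple, cross it in one step,
  and return to \<open>x\<close> by undoing \<open>w\<close>. The crossing is the +1 in 2r +
  1.\<close>

lemma walk_step: "x \<in> U \<Longrightarrow> t \<in> R i \<Longrightarrow> i \<in> I \<Longrightarrow> set w \<subseteq> {..<D} \<Longrightarrow> set v \<subseteq> {..<D} \<Longrightarrow>
    fold nbr w x \<in> set t \<Longrightarrow> fold nbr v y \<in> set t \<Longrightarrow> y \<in> U \<Longrightarrow>
    \<exists>u\<in>words (length v + length w + 1). x = fold nbr u y"
proof -
  assume a: "x \<in> U" "t \<in> R i" "i \<in> I" "set w \<subseteq> {..<D}" "set v \<subseteq> {..<D}"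
    "fold nbr w x \<in> set t" "fold nbr v y \<in> set t" "y \<in> U"
  obtain k where k: "k < D" "nbr k (fold nbr v y) = fold nbr w x"
    using nbr_onto a by metis
  obtain u where u: "set u \<subseteq> {..<D}" "length u = length w" "fold nbr u (fold nbr w x) = x"
    using walk_back a by metis
  have "fold nbr (v @ [k] @ u) y = x"
    using k u by simp
  moreover have "v @ [k] @ u \<in> words (length v + length w + 1)"
    using k u a by (auto simp: words_def)
  ultimately show ?thesis by metis
qed

lemma comp_self: "x \<in> comp x"
  unfolding comp_def by (auto intro: exI[of _ "[]"])

lemma comp_subset_U: "x \<in> U \<Longrightarrow> comp x \<subseteq> U"
  unfolding comp_def using walk_in_U by auto

lemma comp_trans: "y \<in> comp x \<Longrightarrow> comp y \<subseteq> comp x"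
proof
  fix z assume "y \<in> comp x" "z \<in> comp y"
  then obtain w v where "set w \<subseteq> {..<D}" "y = fold nbr w x" "set v \<subseteq> {..<D}" "z = fold nbr v y"
    unfolding comp_def by auto
  then show "z \<in> comp x"
    unfolding comp_def by (auto intro!: exI[of _ "w @ v"])
qed

lemma comp_sym: "x \<in> U \<Longrightarrow> y \<in> comp x \<Longrightarrow> x \<in> comp y"
  unfolding comp_def using walk_back by (smt (verit, best) mem_Collect_eq)

lemma comp_eq: "x \<in> U \<Longrightarrow> y \<in> comp x \<Longrightarrow> comp y = comp x"
  using comp_sym comp_trans by blast

lemma tuple_in_comp: "i \<in> I \<Longrightarrow> t \<in> R i \<Longrightarrow> x \<in> set t \<Longrightarrow> set t \<subseteq> comp x"
proof
  fix y assume "i \<in> I" "t \<in> R i" "x \<in> set t" "y \<in> set t"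
  then obtain k where "k < D" "nbr k x = y"
    using nbr_onto by metis
  then show "y \<in> comp x"
    unfolding comp_def by (auto intro!: exI[of _ "[k]"])
qed

lemma closed_imp_comp_subset:
  assumes "x \<in> S" "\<And>y k. y \<in> S \<Longrightarrow> k < D \<Longrightarrow> nbr k y \<in> S"
  shows "comp x \<subseteq> S"
proof -
  have "set w \<subseteq> {..<D} \<Longrightarrow> x \<in> S \<Longrightarrow> fold nbr w x \<in> S" for w x
    by (induction w arbitrary: x) (auto simp: assms(2))
  then show ?thesis
    using assms(1) unfolding comp_def by auto
qed

section \<open>Correspondences that preserve tuples\<close>

lemma presD:
  "pres P \<Longrightarrow> i \<in> I \<Longrightarrow> list_all2 (\<lambda>a b. (a, b) \<in> P) s t \<Longrightarrow> s \<in> R i \<longleftrightarrow> t \<in> R i"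
  unfolding pres_def by blast

lemma pres_mono: "pres P \<Longrightarrow> Q \<subseteq> P \<Longrightarrow> pres Q"
  unfolding pres_def by (meson list_all2_mono subsetD)

lemma pres_converse: "pres (P\<inverse>) \<longleftrightarrow> pres P"
proof -
  have "list_all2 (\<lambda>a b. (a, b) \<in> P\<inverse>) s t \<longleftrightarrow> list_all2 (\<lambda>a b. (a, b) \<in> P) t s" for s t
    by (auto simp: list_all2_conv_all_nth)
  then show ?thesis
    unfolding pres_def by blast
qed

lemma pres_comp: "pres P \<Longrightarrow> pres Q \<Longrightarrow> pres (P O Q)"
proof -
  assume P: "pres P" and Q: "pres Q"
  show ?thesis
    unfolding pres_def
  proof (intro ballI allI impI)
    fix i s u assume i: "i \<in> I" and *: "list_all2 (\<lambda>a b. (a, b) \<in> P O Q) s u"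
    then have "list_all2 ((\<lambda>a b. (a, b) \<in> P) OO (\<lambda>a b. (a, b) \<in> Q)) s u"
      by (auto elim!: list_all2_mono)
    then obtain t where "list_all2 (\<lambda>a b. (a, b) \<in> P) s t" "list_all2 (\<lambda>a b. (a, b) \<in> Q) t u"
      unfolding list.rel_compp by auto
    then show "s \<in> R i \<longleftrightarrow> u \<in> R i"
      using presD[OF P i] presD[OF Q i] by metis
  qed
qed

lemma pres_Id: "P \<subseteq> Id \<Longrightarrow> pres P"
proof -
  assume "P \<subseteq> Id"
  then have "list_all2 (\<lambda>a b. (a, b) \<in> P) s t \<Longrightarrow> s = t" for s t
    by (auto simp: list_all2_conv_all_nth intro!: nth_equalityI)
  then show ?thesis
    unfolding pres_def by blast
qed

lemma spread_0 [simp]: "spread 0 P = P"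
  unfolding spread_def words_def by auto

lemma spread_mono: "P \<subseteq> Q \<Longrightarrow> r \<le> s \<Longrightarrow> spread r P \<subseteq> spread s Q"
  unfolding spread_def words_def by fastforce

lemma pres_spread_mono: "pres (spread s Q) \<Longrightarrow> P \<subseteq> Q \<Longrightarrow> r \<le> s \<Longrightarrow> pres (spread r P)"
  using pres_mono spread_mono by metis

lemma pair_in_eq: "[x, y] \<in> R eq \<longleftrightarrow> x = y \<and> x \<in> U"
  unfolding R_eq by auto

lemma spread_Un: "spread r (P \<union> Q) = spread r P \<union> spread r Q"
  unfolding spread_def by auto

lemma spread_converse: "spread r (P\<inverse>) = (spread r P)\<inverse>"
  unfolding spread_def by auto

lemma spread_Id_on: "spread r (Id_on S) \<subseteq> Id"
  unfolding spread_def by auto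

lemma pres_spread_Id_on: "pres (spread r (Id_on S))"
  using pres_Id spread_Id_on .

lemma spread_walk:
  "(a, b) \<in> P \<Longrightarrow> w \<in> words s \<Longrightarrow> spread r {(fold nbr w a, fold nbr w b)} \<subseteq> spread (s + r) P"
proof
  fix p assume a: "(a, b) \<in> P" "w \<in> words s" "p \<in> spread r {(fold nbr w a, fold nbr w b)}"
  then obtain v where "v \<in> words r" "p = (fold nbr v (fold nbr w a), fold nbr v (fold nbr w b))"
    unfolding spread_def by auto
  then have "p = (fold nbr (w @ v) a, fold nbr (w @ v) b)" "w @ v \<in> words (s + r)"
    using a by (auto simp: words_def)
  with a show "p \<in> spread (s + r) P"
    unfolding spread_def by blast
qed

text \<open>By \<open>walk_step\<close>, a tuple meeting both the ball of \<open>x\<close> and the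
  balls around the domain of \<open>P\<close> would bring \<open>x\<close> within 2r + 1 of that
  domain. So \<open>s\<close> lies in one of the two parts, where preservation is assumed. Only one
  implication is claimed because distance is controlled on the left side alone.\<close>

lemma far_transfer:
  assumes P: "P \<subseteq> U \<times> U" "x \<in> U" "pres (spread r P)" "pres (spread r {(x, y)})"
    and far: "\<And>a b w. (a, b) \<in> P \<Longrightarrow> w \<in> words (2 * r + 1) \<Longrightarrow> x \<noteq> fold nbr w a"
    and l: "list_all2 (\<lambda>a b. (a, b) \<in> spread r (insert (x, y) P)) s t"
    and i: "i \<in> I" and s: "s \<in> R i"
  shows "t \<in> R i"
proof -
  have un: "spread r (insert (x, y) P) = spread r {(x, y)} \<union> spread r P"
    using spread_Un[of r "{(x, y)}" P] by simp
  have cross: False if c: "(c, d) \<in> spread r {(x, y)}" and c': "(c', d') \<in> spread r P" and cs: "c \<in> set s" "c' \<in> set s"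
    for c d c' d'
  proof -
    obtain w where w: "w \<in> words r" "c = fold nbr w x"
      using c unfolding spread_def by blast
    obtain v a b where v: "v \<in> words r" "c' = fold nbr v a" "(a, b) \<in> P"
      using c' unfolding spread_def by auto
    have "a \<in> U" using v P by auto
    then obtain u where u: "u \<in> words (length v + length w + 1)" "x = fold nbr u a"
      using walk_step[of x s i w v a] cs P w v s i by (auto simp: words_def)
    then have "u \<in> words (2 * r + 1)"
      using w v by (auto simp: words_def)
    then show False
      using far v u by blast
  qed
  have "list_all2 (\<lambda>a b. (a, b) \<in> spread r {(x, y)}) s t \<or> list_all2 (\<lambda>a b. (a, b) \<in> spread r P) s t"
  \<comment> \<open>An entry outside one part lies in the other, so failure of both alternatives
    gives an entry in each part, which \<open>cross\<close> forbids.\<close>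
  proof (rule ccontr)
    assume "\<not> ?thesis"
    then obtain m n where mn: "m < length s" "n < length s" "(s ! m, t ! m) \<notin> spread r {(x, y)}"
        "(s ! n, t ! n) \<notin> spread r P" "length s = length t"
      using l by (auto simp: list_all2_conv_all_nth)
    then have "(s ! m, t ! m) \<in> spread r P" "(s ! n, t ! n) \<in> spread r {(x, y)}"
      using l un by (auto simp: list_all2_conv_all_nth)
    then show False
      using cross mn by (metis nth_mem)
  qed
  then show ?thesis
    using assms presD by metis
qed

lemma finite_near: "finite P \<Longrightarrow> finite {fold nbr w b | w a b. w \<in> words r \<and> (a, b) \<in> P}"
proof -
  assume "finite P"
  then have "finite ((\<lambda>(w, a, b). fold nbr w b) ` (words r \<times> P))"
    by (intro finite_imageI finite_cartesian_product) auto
  then show ?thesis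
    by (rule rev_finite_subset) force
qed

text \<open>\<open>V\<close> is separate from \<open>U\<close> because in the extension the partners
  are sought among the points of \<open>M\<close> only.\<close>

definition rich :: "nat \<Rightarrow> 'a set \<Rightarrow> 'a \<Rightarrow> bool" where
  "rich r V x \<longleftrightarrow> infinite {y \<in> V. pres (spread r {(x, y)})}"

text \<open>
  A point within distance \<open>2 * r + 1\<close> of the domain is answered along the same word. Otherwise no
  tuple meets both its \<open>r\<close>-neighbourhood and that of the domain, so any sufficiently remote point
  with the same \<open>r\<close>-neighbourhood will do.
\<close>

lemma extend_pres:
  assumes P: "finite P" "P \<subseteq> U \<times> U" "pres (spread (3 * r + 1) P)" and x: "x \<in> U"
    and V: "V \<subseteq> U"
    and rich: "(x, x) \<notin> P \<Longrightarrow> rich r V x"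
  obtains y where "y \<in> U" "pres (spread r (insert (x, y) P))"
    "y \<in> V \<or> (\<exists>w a b. (a, b) \<in> P \<and> set w \<subseteq> {..<D} \<and> y = fold nbr w b)"
proof (cases "\<exists>a b w. (a, b) \<in> P \<and> w \<in> words (2 * r + 1) \<and> x = fold nbr w a")
  case True
  then obtain a b w where w: "(a, b) \<in> P" "w \<in> words (2 * r + 1)" "x = fold nbr w a"
    by blast
  let ?y = "fold nbr w b"
  have "spread r (insert (x, ?y) P) = spread r {(x, ?y)} \<union> spread r P"
    using spread_Un[of r "{(x, ?y)}" P] by simp
  also have "\<dots> \<subseteq> spread (3 * r + 1) P"
    using spread_walk[OF w(1,2), of r] spread_mono[of P P r "3 * r + 1"] w(3)
    by (simp add: algebra_simps)
  finally have "pres (spread r (insert (x, ?y) P))"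
    using P pres_mono by blast
  moreover have "?y \<in> U"
    using w P walk_in_U by (auto simp: words_def)
  ultimately show ?thesis
    using that w by (auto simp: words_def)
next
  case far: False
  \<comment> \<open>A point paired with itself is reached by the empty word, so a far point is not
    among these and its richness is available.\<close>
  have "(x, x) \<notin> P"
  proof
    assume "(x, x) \<in> P"
    moreover have "[] \<in> words (2 * r + 1)" by (simp add: words_def)
    ultimately show False using far by (metis fold_simps(1))
  qed
  then have "infinite ({y \<in> V. pres (spread r {(x, y)})} -
      {fold nbr w b | w a b. w \<in> words (2 * r + 1) \<and> (a, b) \<in> P})"
    using rich[unfolded rich_def] finite_near[OF P(1)] by (intro Diff_infinite_finite)
  then obtain y where y: "y \<in> V" "pres (spread r {(x, y)})"
      and fary: "\<And>a b w. w \<in> words (2 * r + 1) \<Longrightarrow> (a, b) \<in> P \<Longrightarrow> y \<noteq> fold nbr w b"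
    by (smt (verit) DiffD1 DiffD2 ex_in_conv finite.emptyI mem_Collect_eq)
  have Pr: "pres (spread r P)"
    using P pres_mono spread_mono[of P P r "3 * r + 1"] by auto
  \<comment> \<open>The reverse implication is \<open>far_transfer\<close> for the converse
    relation. It needs \<open>y\<close> far from the range of \<open>P\<close>, which is why the
    points near second coordinates were removed.\<close>
  have swap: "spread r (insert (y, x) (P\<inverse>)) = (spread r (insert (x, y) P))\<inverse>"
    unfolding spread_converse[symmetric] by (rule arg_cong[where f = "spread r"]) auto
  have single: "pres (spread r {(y, x)})"
  proof -
    have "{(y, x)} = {(x, y)}\<inverse>" by auto
    then show ?thesis
      using y(2) by (simp only: spread_converse pres_converse)
  qed
  have "pres (spread r (insert (x, y) P))"
    unfolding pres_def
  proof (intro ballI allI impI iffI)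
    fix i s t assume i: "i \<in> I" and l: "list_all2 (\<lambda>a b. (a, b) \<in> spread r (insert (x, y) P)) s t"
    show "t \<in> R i" if "s \<in> R i"
      using far_transfer[OF P(2) x Pr y(2) _ l i that] far by blast
    have l': "list_all2 (\<lambda>a b. (a, b) \<in> spread r (insert (y, x) (P\<inverse>))) t s"
      using l unfolding swap by (auto simp: list_all2_conv_all_nth)
    show "s \<in> R i" if "t \<in> R i"
    proof (rule far_transfer[OF _ _ _ single _ l' i that])
      show "P\<inverse> \<subseteq> U \<times> U" using P by auto
      show "y \<in> U" using y V by auto
      show "pres (spread r (P\<inverse>))" using Pr by (simp add: spread_converse pres_converse)
      show "y \<noteq> fold nbr w a" if "(a, b) \<in> P\<inverse>" "w \<in> words (2 * r + 1)" for a b w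
        using fary that by blast
    qed
  qed
  then show ?thesis
    using that y V by blast
qed

section \<open>Types of neighbourhoods\<close>

definition profile :: "nat \<Rightarrow> 'a \<Rightarrow> ('i \<times> nat list list) set" where
  "profile r x = {(i, ws). i \<in> I \<and> set ws \<subseteq> words r \<and> length ws = ar i \<and>
     map (\<lambda>w. fold nbr w x) ws \<in> R i}"

lemma finite_profiles: "finite (range (profile r))"
proof -
  let ?S = "Sigma I (\<lambda>i. {ws. set ws \<subseteq> words r \<and> length ws = ar i})"
  have "finite ?S"
    by (intro finite_SigmaI finite_I finite_lists_length_eq) auto
  moreover have "profile r x \<subseteq> ?S" for x
    unfolding profile_def by auto
  ultimately show ?thesis
    by (meson finite_Pow_iff finite_subset image_subsetI PowI)
qed

text \<open>Entries of \<open>s\<close> and \<open>t\<close> at the same index are ends of a common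
  word, so both lists are images of one list of words, whose membership the profiles record.\<close>

lemma same_profile_pres:
  assumes "profile r x = profile r y"
  shows "pres (spread r {(x, y)})"
  unfolding pres_def
proof (intro ballI allI impI)
  fix i s t assume i: "i \<in> I" and l: "list_all2 (\<lambda>a b. (a, b) \<in> spread r {(x, y)}) s t"
  then have "\<forall>n<length s. \<exists>w\<in>words r. s ! n = fold nbr w x \<and> t ! n = fold nbr w y"
    unfolding spread_def by (auto simp: list_all2_conv_all_nth)
  then obtain f where f: "\<And>n. n < length s \<Longrightarrow> f n \<in> words r"
      "\<And>n. n < length s \<Longrightarrow> s ! n = fold nbr (f n) x" "\<And>n. n < length s \<Longrightarrow> t ! n = fold nbr (f n) y"
    by metis
  define ws where "ws = map f [0..<length s]"
  have st: "s = map (\<lambda>w. fold nbr w x) ws" "t = map (\<lambda>w. fold nbr w y) ws"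
    using f l by (auto simp: ws_def list_all2_conv_all_nth intro!: nth_equalityI)
  have "set ws \<subseteq> words r"
    using f by (auto simp: ws_def)
  then have "u \<in> {x, y} \<Longrightarrow> (i, ws) \<in> profile r u \<longleftrightarrow> map (\<lambda>w. fold nbr w u) ws \<in> R i" for u
    unfolding profile_def using i R_tuple[of i "map (\<lambda>w. fold nbr w u) ws"] by auto
  then show "s \<in> R i \<longleftrightarrow> t \<in> R i"
    using st assms by auto
qed

text \<open>The profile of a point that is not rich is realised only finitely often, and there are
  only finitely many profiles.\<close>

lemma finite_exceptions: "finite {x \<in> U. \<not> rich r U x}"
proof -
  let ?T = "{\<tau> \<in> range (profile r). finite {y \<in> U. profile r y = \<tau>}}"
  have "{x \<in> U. \<not> rich r U x} \<subseteq> (\<Union>\<tau>\<in>?T. {y \<in> U. profile r y = \<tau>})"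
  proof
    fix x assume x: "x \<in> {x \<in> U. \<not> rich r U x}"
    then have "finite {y \<in> U. pres (spread r {(x, y)})}"
      unfolding rich_def by simp
    then have "finite {y \<in> U. profile r y = profile r x}"
      by (rule rev_finite_subset) (auto intro: same_profile_pres)
    then show "x \<in> (\<Union>\<tau>\<in>?T. {y \<in> U. profile r y = \<tau>})"
      using x by auto
  qed
  then show ?thesis
    by (rule finite_subset) (use finite_profiles in auto)
qed

end

section \<open>Limits of components\<close>

text \<open>Pigeonhole alone yields a choice that is right infinitely often; \<open>dec\<close>
  improves this to eventually. It does the work of an ultrafilter in the limit construction.\<close>

lemma eventually_pigeonhole:
  fixes P :: "'k \<Rightarrow> nat \<Rightarrow> bool"
  assumes "finite K" and ev: "\<forall>\<^sub>F n in sequentially. \<exists>k\<in>K. P k n"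
    and dec: "\<And>k. k \<in> K \<Longrightarrow> (\<forall>\<^sub>F n in sequentially. P k n) \<or> (\<forall>\<^sub>F n in sequentially. \<not> P k n)"
  shows "\<exists>k\<in>K. \<forall>\<^sub>F n in sequentially. P k n"
proof (rule ccontr)
  assume "\<not> ?thesis"
  then have "\<forall>k\<in>K. \<forall>\<^sub>F n in sequentially. \<not> P k n"
    using dec by blast
  then have "\<forall>\<^sub>F n in sequentially. \<forall>k\<in>K. \<not> P k n"
    using assms(1) by (simp add: eventually_ball_finite)
  then have "\<forall>\<^sub>F n in sequentially. False"
    using ev by eventually_elim auto
  then show False by simp
qed

lemma injective_choice:
  fixes X :: "nat \<Rightarrow> 'a set"
  assumes "\<And>n. infinite (X n)"
  shows "\<exists>f. inj f \<and> (\<forall>n. f n \<in> X n)"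
proof -
  have "\<exists>f. \<forall>n::nat. f n \<in> X n - f ` {..<n}"
  proof (rule dependent_wellorder_choice)
    fix n and f :: "nat \<Rightarrow> 'a"
    have "infinite (X n - f ` {..<n})"
      using assms by (simp add: Diff_infinite_finite)
    then show "\<exists>r. r \<in> X n - f ` {..<n}"
      using infinite_imp_nonempty by blast
  qed force
  then obtain f where f: "\<And>n::nat. f n \<in> X n" "\<And>n m. m < n \<Longrightarrow> f n \<noteq> f m"
    by (metis DiffD1 DiffD2 image_eqI lessThan_iff)
  then have "inj f"
    by (metis injI linorder_neqE_nat)
  then show ?thesis
    using f by blast
qed

section \<open>A convergent sequence of points in growing components\<close>

context labelled_structure
begin

text \<open>If the set were finite, a component larger than both \<open>m\<close> and that set would
  exist; all its points belong to the set, which is absurd. An infinite component and unbounded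
  finite ones are covered alike.\<close>

lemma infinite_large_comps:
  assumes "\<And>b. \<exists>x\<in>U. \<not> (finite (comp x) \<and> card (comp x) \<le> b)"
  shows "infinite {x \<in> U. finite (comp x) \<longrightarrow> m \<le> card (comp x)}" (is "infinite ?X")
proof
  assume fin: "finite ?X"
  obtain x where x: "x \<in> U" "\<not> (finite (comp x) \<and> card (comp x) \<le> max m (card ?X))"
    using assms by blast
  then have "x \<in> ?X" by auto
  have "y \<in> ?X" if "y \<in> comp x" for y
    using comp_eq[OF x(1) that] comp_subset_U[OF x(1)] that \<open>x \<in> ?X\<close> by auto
  then have "comp x \<subseteq> ?X" by blast
  then show False
    using x(2) fin card_mono[OF fin] finite_subset[OF _ fin] by (simp add: le_max_iff_disj)
qed

text \<open>For one radius a subsequence with constant profile exists because profiles are finite in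
  number; a diagonal subsequence serves all radii. Injectivity will make the types of the limit
  occur at infinitely many points.\<close>

lemma convergent_sequence:
  assumes "\<And>b. \<exists>x\<in>U. \<not> (finite (comp x) \<and> card (comp x) \<le> b)"
  obtains p :: "nat \<Rightarrow> 'a" where "inj p" "\<And>n. p n \<in> U"
    "\<And>n. finite (comp (p n)) \<Longrightarrow> n \<le> card (comp (p n))"
    "\<And>r. \<exists>\<tau>. \<forall>\<^sub>F n in sequentially. profile r (p n) = \<tau>"
proof -
  let ?X = "\<lambda>m. {x \<in> U. finite (comp x) \<longrightarrow> m \<le> card (comp x)}"
  obtain q where q: "inj q" "\<And>n. q n \<in> ?X n"
    using injective_choice[of ?X, OF infinite_large_comps[OF assms]] by blast
  interpret subseqs "\<lambda>r s. \<exists>\<tau>. \<forall>n. profile r (q (s n)) = \<tau>"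
  proof
    fix r and s :: "nat \<Rightarrow> nat"
    have "finite (range (\<lambda>n. profile r (q (s n))))"
      by (rule finite_subset[OF _ finite_profiles[of r]]) auto
    then obtain n0 where "infinite {n. profile r (q (s n)) = profile r (q (s n0))}"
      using pigeonhole_infinite[OF infinite_UNIV_nat] by auto
    then obtain u :: "nat \<Rightarrow> nat" where
      u: "strict_mono u" "\<And>n. u n \<in> {n. profile r (q (s n)) = profile r (q (s n0))}"
      using infinite_enumerate by blast
    then show "\<exists>u :: nat \<Rightarrow> nat. strict_mono u \<and> (\<exists>\<tau>. \<forall>n. profile r (q ((s \<circ> u) n)) = \<tau>)"
      by (intro exI[of _ u] conjI exI[of _ "profile r (q (s n0))"]) auto
  qed
  show ?thesis
  proof
    show "inj (q \<circ> diagseq)"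
      using q(1) subseq_diagseq by (simp add: inj_compose strict_mono_imp_inj_on)
    show "(q \<circ> diagseq) n \<in> U" for n
      using q(2) by simp
    \<comment> \<open>A subsequence only raises indices, so the lower bound on component sizes
      survives.\<close>
    show "n \<le> card (comp ((q \<circ> diagseq) n))" if "finite (comp ((q \<circ> diagseq) n))" for n
      using q(2)[of "diagseq n"] that seq_suble[OF subseq_diagseq, of n] by simp
    show "\<exists>\<tau>. \<forall>\<^sub>F n in sequentially. profile r ((q \<circ> diagseq) n) = \<tau>" for r
    proof -
      \<comment> \<open>The diagonal sequence meets the condition for \<open>r\<close> only after
        its first \<open>Suc r\<close> terms are dropped.\<close>
      have "\<exists>\<tau>. \<forall>n. profile r (q ((diagseq \<circ> ((+) (Suc r))) n)) = \<tau>"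
      proof (rule diagseq_holds)
        fix u s :: "nat \<Rightarrow> nat" and n
        assume "\<exists>\<tau>. \<forall>m. profile n (q (s m)) = \<tau>"
        then show "\<exists>\<tau>. \<forall>m. profile n (q ((s \<circ> u) m)) = \<tau>"
          unfolding o_def by blast
      qed
      then obtain \<tau> where \<tau>: "\<And>n. profile r (q (diagseq (Suc r + n))) = \<tau>"
        by auto
      have "profile r (q (diagseq n)) = \<tau>" if n: "Suc r \<le> n" for n
      proof -
        obtain k where "n = Suc r + k"
          using le_Suc_ex[OF n] by blast
        then show ?thesis
          using \<tau> by simp
      qed
      then show ?thesis
        unfolding eventually_sequentially o_def by blast
    qed
  qed
qed

end

locale limit_component = labelled_structure U I ar R eq D nbr
  for U :: "'a set" and I :: "'i set" and ar R eq D nbr +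
  fixes p :: "nat \<Rightarrow> 'a"
  assumes inj_p: "inj p" and p_in_U: "p n \<in> U"
    and large: "finite (comp (p n)) \<Longrightarrow> n \<le> card (comp (p n))"
    and convergent: "\<exists>\<tau>. \<forall>\<^sub>F n in sequentially. profile r (p n) = \<tau>"
begin

text \<open>
  The elements of the limit component are words, read as walks from \<open>p n\<close> for large \<open>n\<close> and
  identified by \<open>sim\<close>; \<open>emb j w\<close> is the element named by \<open>w\<close> in the \<open>j\<close>-th copy.
\<close>

abbreviation W :: "nat list set" where "W \<equiv> lists {..<D}"

definition holds :: "'i \<Rightarrow> nat list list \<Rightarrow> bool" where
  "holds i ws \<longleftrightarrow> (\<forall>\<^sub>F n in sequentially. map (\<lambda>w. fold nbr w (p n)) ws \<in> R i)"

definition sim :: "nat list \<Rightarrow> nat list \<Rightarrow> bool" where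
  "sim w v \<longleftrightarrow> (\<forall>\<^sub>F n in sequentially. fold nbr w (p n) = fold nbr v (p n))"

text \<open>The profile at a radius bounding all words of \<open>ws\<close> stabilises and decides
  membership for large n. Thus eventual truth commutes with negation, and the limit leaves no tuple
  undecided.\<close>

lemma holds_dichotomy:
  assumes "i \<in> I" "ws \<in> lists W"
  shows "holds i ws \<or> (\<forall>\<^sub>F n in sequentially. map (\<lambda>w. fold nbr w (p n)) ws \<notin> R i)"
proof (cases "length ws = ar i")
  case True
  define r where "r = Max (insert 0 (length ` set ws))"
  have ws: "set ws \<subseteq> words r"
    using assms(2) by (auto simp: r_def words_def)
  obtain \<tau> where "\<forall>\<^sub>F n in sequentially. profile r (p n) = \<tau>"
    using convergent by blast
  then have "\<forall>\<^sub>F n in sequentially. map (\<lambda>w. fold nbr w (p n)) ws \<in> R i \<longleftrightarrow> (i, ws) \<in> \<tau>"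
    by eventually_elim (use True ws assms(1) in \<open>auto simp: profile_def\<close>)
  then show ?thesis
    unfolding holds_def by (cases "(i, ws) \<in> \<tau>") (auto elim: eventually_mono)
next
  case False
  then have "map (\<lambda>w. fold nbr w (p n)) ws \<notin> R i" for n
    using R_tuple[OF assms(1)] by fastforce
  then show ?thesis by simp
qed

lemma walk_p_in_U: "w \<in> W \<Longrightarrow> fold nbr w (p n) \<in> U"
  using walk_in_U[OF p_in_U] by (simp add: lists_eq_set)

lemma holds_eq: "w \<in> W \<Longrightarrow> holds eq [w, v] \<longleftrightarrow> sim w v"
  unfolding holds_def sim_def R_eq using walk_p_in_U by (auto elim: eventually_mono)

lemma sim_dichotomy:
  assumes "w \<in> W" "v \<in> W"
  shows "sim w v \<or> (\<forall>\<^sub>F n in sequentially. fold nbr w (p n) \<noteq> fold nbr v (p n))"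
proof -
  have "map (\<lambda>w. fold nbr w (p n)) [w, v] \<in> R eq \<longleftrightarrow> fold nbr w (p n) = fold nbr v (p n)" for n
    using walk_p_in_U[OF assms(1)] by (auto simp: R_eq)
  then show ?thesis
    using holds_dichotomy[OF eq_in, of "[w, v]"] holds_eq[OF assms(1), of v] assms
    by (simp only: lists.Cons lists.Nil)
qed

lemma sim_refl [simp]: "sim w w"
  unfolding sim_def by simp

lemma sim_sym: "sim w v \<Longrightarrow> sim v w"
  unfolding sim_def by (simp add: eq_commute)

lemma sim_trans: "sim w v \<Longrightarrow> sim v u \<Longrightarrow> sim w u"
  unfolding sim_def by (auto elim: eventually_elim2)

lemma sim_append: "sim w v \<Longrightarrow> sim (w @ u) (v @ u)"
  unfolding sim_def by (auto elim: eventually_mono)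

lemma holds_cong:
  assumes "list_all2 sim ws vs" "holds i ws"
  shows "holds i vs"
proof -
  have "\<forall>\<^sub>F n in sequentially. \<forall>k\<in>{..<length ws}. fold nbr (ws ! k) (p n) = fold nbr (vs ! k) (p n)"
    using assms(1) by (intro eventually_ball_finite) (auto simp: list_all2_conv_all_nth sim_def)
  then have "\<forall>\<^sub>F n in sequentially. map (\<lambda>w. fold nbr w (p n)) ws = map (\<lambda>w. fold nbr w (p n)) vs"
    by eventually_elim (use assms(1) in \<open>auto simp: list_all2_conv_all_nth intro: nth_equalityI\<close>)
  then show ?thesis
    using assms(2) unfolding holds_def by eventually_elim simp
qed

definition cls :: "nat list \<Rightarrow> nat list set" where
  "cls w = {v \<in> W. sim w v}"

lemma cls_eq: "w \<in> W \<Longrightarrow> v \<in> W \<Longrightarrow> cls w = cls v \<longleftrightarrow> sim w v"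
  unfolding cls_def using sim_refl sim_sym sim_trans by blast

definition emb :: "nat \<Rightarrow> nat list \<Rightarrow> 'a + nat" where
  "emb j w = Inr (to_nat_on (UNIV \<times> cls ` W) (j, cls w))"

text \<open>Having infinitely many copies makes the product infinite, and words make it countable,
  so the numbering uses every natural and the new points are exactly the values of
  \<open>Inr\<close>.\<close>

lemma emb_bij: "bij_betw (to_nat_on (UNIV \<times> cls ` W)) ((UNIV :: nat set) \<times> cls ` W) UNIV"
proof (rule to_nat_on_infinite)
  show "infinite ((UNIV :: nat set) \<times> cls ` W)"
    by (auto simp: finite_cartesian_product_iff)
qed simp

lemma emb_eq: "w \<in> W \<Longrightarrow> v \<in> W \<Longrightarrow> emb j w = emb k v \<longleftrightarrow> j = k \<and> sim w v"
proof -
  assume W: "w \<in> W" "v \<in> W"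
  then have "emb j w = emb k v \<longleftrightarrow> (j, cls w) = (k, cls v)"
    unfolding emb_def sum.inject by (intro inj_on_eq_iff[OF bij_betw_imp_inj_on[OF emb_bij]]) blast+
  then show ?thesis
    using cls_eq[OF W] by blast
qed

lemma emb_surj: "\<exists>j. \<exists>w\<in>W. Inr n = emb j w"
proof -
  have "n \<in> to_nat_on (UNIV \<times> cls ` W) ` ((UNIV :: nat set) \<times> cls ` W)"
    using bij_betw_imp_surj_on[OF emb_bij] by simp
  then obtain j w where "w \<in> W" "n = to_nat_on (UNIV \<times> cls ` W) (j :: nat, cls w)"
    by blast
  then show ?thesis
    unfolding emb_def by (intro exI[of _ j] bexI[of _ w]) simp_all
qed

lemma emb_not_Inl [simp]: "emb j w \<noteq> Inl x" "Inl x \<noteq> emb j w"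
  by (auto simp: emb_def)

definition UQ :: "('a + nat) set" where
  "UQ = Inl ` U \<union> range Inr"

text \<open>No tuple joins two copies, or a copy to \<open>M\<close>. Only the empty tuple can come
  from both parts, and they agree on it.\<close>

definition RQ :: "'i \<Rightarrow> ('a + nat) list set" where
  "RQ i = map Inl ` R i \<union> {map (emb j) ws | j ws. ws \<in> lists W \<and> holds i ws}"

definition nbrQ :: "nat \<Rightarrow> 'a + nat \<Rightarrow> 'a + nat" where
  "nbrQ k z = (case z of Inl x \<Rightarrow> Inl (nbr k x)
     | Inr n \<Rightarrow> (let (j, w) = (SOME (j, w). w \<in> W \<and> Inr n = emb j w) in emb j (w @ [k])))"

lemma nbrQ_Inl [simp]: "nbrQ k (Inl x) = Inl (nbr k x)"
  unfolding nbrQ_def by simp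

text \<open>The word picked by \<open>SOME\<close> is irrelevant, because \<open>sim\<close> is
  stable under appending a letter.\<close>

lemma nbrQ_emb: "w \<in> W \<Longrightarrow> k < D \<Longrightarrow> nbrQ k (emb j w) = emb j (w @ [k])"
proof -
  assume w: "w \<in> W" and k: "k < D"
  obtain n where n: "emb j w = Inr n"
    unfolding emb_def by blast
  obtain j' w' where jw: "(SOME (j, w). w \<in> W \<and> Inr n = emb j w) = (j', w')"
    by fastforce
  have "case (j', w') of (j, w) \<Rightarrow> w \<in> W \<and> Inr n = emb j w"
    unfolding jw[symmetric] by (rule someI_ex) (use w in \<open>auto intro!: exI[of _ j] exI[of _ w] simp: n\<close>)
  then have w': "w' \<in> W" and "emb j' w' = emb j w"
    using n by simp_all
  then have "j' = j" "sim w' w"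
    using emb_eq[OF w' w, of j' j] by simp_all
  then have "emb j' (w' @ [k]) = emb j (w @ [k])"
    using emb_eq[of "w' @ [k]" "w @ [k]" j' j] w w' k sim_append by simp
  then show ?thesis
    unfolding nbrQ_def n using jw by simp
qed

lemma emb_in_UQ [simp]: "emb j w \<in> UQ"
  unfolding emb_def UQ_def by simp

lemma UQ_cases:
  assumes "z \<in> UQ"
  obtains x where "x \<in> U" "z = Inl x" | j w where "w \<in> W" "z = emb j w"
  using assms emb_surj unfolding UQ_def by blast

lemma walk_Inl: "fold nbrQ w (Inl x) = Inl (fold nbr w x)"
  by (induction w arbitrary: x) auto

lemma walk_emb: "w \<in> W \<Longrightarrow> v \<in> W \<Longrightarrow> fold nbrQ v (emb j w) = emb j (w @ v)"
  by (induction v arbitrary: w) (auto simp: nbrQ_emb)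

lemma map_Inl_RQ: "map Inl t \<in> RQ i \<longleftrightarrow> t \<in> R i"
proof
  assume "map Inl t \<in> RQ i"
  then consider "map Inl t \<in> (map Inl :: 'a list \<Rightarrow> ('a + nat) list) ` R i"
    | j ws where "map Inl t = map (emb j) ws" "holds i ws"
    unfolding RQ_def by blast
  then show "t \<in> R i"
  proof cases
    case 1
    then show ?thesis
      by (auto simp: inj_map_eq_map)
  next
    case 2
    then have "t = []" "ws = []"
      by (cases t; cases ws; auto)+
    then show ?thesis
      using 2 unfolding holds_def by simp
  qed
qed (auto simp: RQ_def)

lemma map_emb_RQ:
  assumes i: "i \<in> I" and ws: "ws \<in> lists W"
  shows "map (emb j) ws \<in> RQ i \<longleftrightarrow> holds i ws"
proof
  assume "map (emb j) ws \<in> RQ i"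
  then consider t where "map (emb j) ws = map Inl t" "t \<in> R i"
    | k vs where "map (emb j) ws = map (emb k) vs" "vs \<in> lists W" "holds i vs"
    unfolding RQ_def by blast
  then show "holds i ws"
  proof cases
    case 1
    then have "t = []" "ws = []"
      by (cases t; cases ws; auto)+
    then show ?thesis
      using 1 unfolding holds_def by simp
  next
    case 2
    then have len: "length vs = length ws"
      by (metis length_map)
    have "sim (vs ! n) (ws ! n)" if "n < length ws" for n
    proof -
      have "emb j (ws ! n) = emb k (vs ! n)"
        using 2(1) that len by (metis nth_map)
      then show ?thesis
        using that len emb_eq ws 2(2) by (metis in_lists_conv_set nth_mem sim_sym)
    qed
    then have "list_all2 sim vs ws"
      using len by (simp add: list_all2_conv_all_nth)
    then show ?thesis
      using holds_cong 2 by blast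
  qed
qed (use ws in \<open>auto simp: RQ_def\<close>)

text \<open>The same labels and the same \<open>D\<close> work for the extension, so walks, profiles
  and richness are available there. The two conditions on \<open>nbrQ\<close> require a single label
  or tuple of words valid for all large n, whereas each \<open>p n\<close> supplies only its own;
  \<open>eventually_pigeonhole\<close> makes them uniform.\<close>

sublocale Q: labelled_structure UQ I ar RQ eq D nbrQ
proof
  show "finite I" by (rule finite_I)
  show "eq \<in> I" by (rule eq_in)
  show "length t = ar i \<and> set t \<subseteq> UQ" if i: "i \<in> I" and t: "t \<in> RQ i" for i t
  proof -
    consider s where "t = map Inl s" "s \<in> R i" | j ws where "t = map (emb j) ws" "holds i ws"
      using t unfolding RQ_def by blast
    then show ?thesis
    proof cases
      case 1
      then show ?thesis
        using R_tuple[OF i] by (auto simp: UQ_def)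
    next
      case 2
      then obtain n where "map (\<lambda>w. fold nbr w (p n)) ws \<in> R i"
        unfolding holds_def by (meson eventually_happens' sequentially_bot)
      then show ?thesis
        using R_tuple[OF i] 2(1) by fastforce
    qed
  qed
  show "RQ eq = {[z, z] | z. z \<in> UQ}"
  proof (intro set_eqI iffI)
    fix t assume "t \<in> RQ eq"
    then consider s where "t = map Inl s" "s \<in> R eq"
      | j ws where "t = map (emb j) ws" "ws \<in> lists W" "holds eq ws"
      unfolding RQ_def by blast
    then show "t \<in> {[z, z] | z. z \<in> UQ}"
    proof cases
      case 1
      then show ?thesis by (auto simp: R_eq UQ_def)
    next
      case 2
      then obtain n where "map (\<lambda>w. fold nbr w (p n)) ws \<in> R eq"
        unfolding holds_def by (meson eventually_happens' sequentially_bot)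
      then obtain w v where "ws = [w, v]"
        by (auto simp: R_eq map_eq_Cons_conv)
      then show ?thesis
        using 2 holds_eq[of w v] emb_eq[of w v j j] by auto
    qed
  next
    fix t assume "t \<in> {[z, z] | z. z \<in> UQ}"
    then obtain z where z: "z \<in> UQ" "t = [z, z]" by blast
    show "t \<in> RQ eq"
    proof (rule UQ_cases[OF z(1)])
      fix x assume "x \<in> U" "z = Inl x"
      then show ?thesis
        using z map_Inl_RQ[of "[x, x]" eq] by (simp add: R_eq)
    next
      fix j w assume "w \<in> W" "z = emb j w"
      then show ?thesis
        using z map_emb_RQ[OF eq_in, of "[w, w]" j] holds_eq[of w w] by simp
    qed
  qed
  show "\<exists>k<D. nbrQ k x = y" if i: "i \<in> I" and t: "t \<in> RQ i" "x \<in> set t" "y \<in> set t" for i t x y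
  proof -
    consider s where "t = map Inl s" "s \<in> R i"
      | j ws where "t = map (emb j) ws" "ws \<in> lists W" "holds i ws"
      using t(1) unfolding RQ_def by blast
    then show ?thesis
    proof cases
      case 1
      then obtain x' y' where "x = Inl x'" "y = Inl y'" "x' \<in> set s" "y' \<in> set s"
        using t by auto
      then show ?thesis
        using nbr_onto[OF i 1(2)] by simp
    next
      case 2
      then obtain w v where w: "w \<in> set ws" "x = emb j w" and v: "v \<in> set ws" "y = emb j v"
        using t by auto
      have W: "w \<in> W" "v \<in> W"
        using w v 2 by auto
      \<comment> \<open>Here the label may still depend on n; there are only \<open>D\<close>
        candidates.\<close>
      have "\<forall>\<^sub>F n in sequentially. \<exists>k\<in>{..<D}. fold nbr (w @ [k]) (p n) = fold nbr v (p n)"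
        using 2(3) unfolding holds_def
        by eventually_elim (use nbr_onto[OF i] w v in fastforce)
      then have "\<exists>k\<in>{..<D}. \<forall>\<^sub>F n in sequentially. fold nbr (w @ [k]) (p n) = fold nbr v (p n)"
      proof (rule eventually_pigeonhole[rotated])
        show "(\<forall>\<^sub>F n in sequentially. fold nbr (w @ [k]) (p n) = fold nbr v (p n)) \<or>
            (\<forall>\<^sub>F n in sequentially. fold nbr (w @ [k]) (p n) \<noteq> fold nbr v (p n))" if "k \<in> {..<D}" for k
          using sim_dichotomy[of "w @ [k]" v] W that unfolding sim_def by simp
      qed simp
      then obtain k where k: "k < D" "sim (w @ [k]) v"
        unfolding sim_def by blast
      then show ?thesis
        using nbrQ_emb[OF W(1) k(1)] w v emb_eq[of "w @ [k]" v j j] W by auto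
    qed
  qed
  show "\<exists>i\<in>I. \<exists>t\<in>RQ i. z \<in> set t \<and> nbrQ k z \<in> set t" if z: "z \<in> UQ" and k: "k < D" for z k
  proof (rule UQ_cases[OF z])
    fix x assume "x \<in> U" "z = Inl x"
    then obtain i t where "i \<in> I" "t \<in> R i" "x \<in> set t" "nbr k x \<in> set t"
      using nbr_mate k by blast
    then show ?thesis
      using \<open>z = Inl x\<close> map_Inl_RQ[of t i] by (intro bexI[of _ i] bexI[of _ "map Inl t"]) auto
  next
    fix j w assume w: "w \<in> W" "z = emb j w"
    \<comment> \<open>All entries of a tuple through the point named by \<open>w\<close> are one
      step away from it, so these finitely many words name them all.\<close>
    let ?Z = "{w, w @ [k]} \<union> (\<lambda>l. w @ [l]) ` {..<D}"
    let ?K = "Sigma I (\<lambda>i. {ws. set ws \<subseteq> ?Z \<and> length ws = ar i} \<inter> {ws. w \<in> set ws \<and> w @ [k] \<in> set ws})"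
    have ZW: "?Z \<subseteq> W"
      using w k by auto
    have "finite ?K"
      by (intro finite_SigmaI finite_I finite_Int disjI1 finite_lists_length_eq) auto
    moreover have "\<exists>q\<in>?K. map (\<lambda>w. fold nbr w (p n)) (snd q) \<in> R (fst q)" for n
    proof -
      let ?x = "fold nbr w (p n)" let ?y = "fold nbr (w @ [k]) (p n)"
      have x: "?x \<in> U" using walk_p_in_U[OF w(1)] .
      show ?thesis
      \<comment> \<open>If both words end at one point, a function from points to words cannot
        produce both \<open>w\<close> and \<open>w @ [k]\<close>; the relation \<open>eq\<close>
        then supplies the tuple.\<close>
      proof (cases "?x = ?y")
        case True
        have "map (\<lambda>w. fold nbr w (p n)) [w, w @ [k]] \<in> R eq"
          using True x by (simp add: R_eq)
        moreover from this have "length [w, w @ [k]] = ar eq"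
          using R_tuple[OF eq_in] by (metis length_map)
        ultimately show ?thesis
          using eq_in by (intro bexI[of _ "(eq, [w, w @ [k]])"]) auto
      next
        case False
        obtain i t where t: "i \<in> I" "t \<in> R i" "?x \<in> set t" "?y \<in> set t"
          using nbr_mate[OF x k] by auto
        have "\<forall>u\<in>set t. \<exists>l<D. nbr l ?x = u"
          using nbr_onto t by blast
        then obtain l where l: "\<And>u. u \<in> set t \<Longrightarrow> l u < D \<and> nbr (l u) ?x = u"
          by metis
        define wd where "wd u = (if u = ?x then w else if u = ?y then w @ [k] else w @ [l u])" for u
        have "map (\<lambda>w. fold nbr w (p n)) (map wd t) = t"
          using l by (auto simp: wd_def map_idI)
        moreover have "wd ?x = w" "wd ?y = w @ [k]"
          using False by (auto simp: wd_def)
        then have "w \<in> set (map wd t)" "w @ [k] \<in> set (map wd t)"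
          using t(3,4) by (metis image_eqI set_map)+
        moreover have "set (map wd t) \<subseteq> ?Z"
          using l by (auto simp: wd_def)
        ultimately show ?thesis
          using t R_tuple[OF t(1,2)] by (intro bexI[of _ "(i, map wd t)"]) auto
      qed
    qed
    then have "\<forall>\<^sub>F n in sequentially. \<exists>q\<in>?K. map (\<lambda>w. fold nbr w (p n)) (snd q) \<in> R (fst q)"
      by simp
    ultimately have "\<exists>q\<in>?K. \<forall>\<^sub>F n in sequentially. map (\<lambda>w. fold nbr w (p n)) (snd q) \<in> R (fst q)"
    proof (rule eventually_pigeonhole)
      fix q assume q: "q \<in> ?K"
      have "set (snd q) \<subseteq> ?Z"
        using q by auto
      then have "snd q \<in> lists W"
        using ZW unfolding lists_eq_set[of W] by blast
      then show "(\<forall>\<^sub>F n in sequentially. map (\<lambda>w. fold nbr w (p n)) (snd q) \<in> R (fst q)) \<or>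
          (\<forall>\<^sub>F n in sequentially. map (\<lambda>w. fold nbr w (p n)) (snd q) \<notin> R (fst q))"
        using holds_dichotomy[of "fst q" "snd q"] q unfolding holds_def by auto
    qed
    then obtain i ws where iw: "i \<in> I" "set ws \<subseteq> ?Z" "w \<in> set ws" "w @ [k] \<in> set ws" "holds i ws"
      unfolding holds_def by auto
    have "ws \<in> lists W"
      using iw(2) ZW unfolding lists_eq_set[of W] by blast
    then have "map (emb j) ws \<in> RQ i"
      using map_emb_RQ iw by blast
    then show ?thesis
      using iw w nbrQ_emb[OF w(1) k] by (intro bexI[of _ i] bexI[of _ "map (emb j) ws"]) auto
  qed
qed

section \<open>The original structure inside the extension\<close>

lemma pres_Inl: "Q.pres (map_prod Inl Inl ` P) \<longleftrightarrow> pres P"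
proof
  assume Q: "Q.pres (map_prod Inl Inl ` P)"
  show "pres P"
    unfolding pres_def
  proof (intro ballI allI impI)
    fix i s t assume i: "i \<in> I" and l: "list_all2 (\<lambda>a b. (a, b) \<in> P) s t"
    have "list_all2 (\<lambda>a b. (a, b) \<in> map_prod Inl Inl ` P) (map Inl s) (map Inl t)"
      using l by (force simp: list_all2_conv_all_nth)
    then show "s \<in> R i \<longleftrightarrow> t \<in> R i"
      using Q.presD[OF Q i] map_Inl_RQ by blast
  qed
next
  assume P: "pres P"
  show "Q.pres (map_prod Inl Inl ` P)"
    unfolding Q.pres_def
  proof (intro ballI allI impI)
    fix i and s t :: "('a + nat) list"
    assume i: "i \<in> I" and l: "list_all2 (\<lambda>a b. (a, b) \<in> map_prod Inl Inl ` P) s t"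
    from l have "\<exists>s' t'. s = map Inl s' \<and> t = map Inl t' \<and> list_all2 (\<lambda>a b. (a, b) \<in> P) s' t'"
    proof (induction rule: list_all2_induct)
      case (Cons a s b t)
      then obtain s' t' a' b' where "s = map Inl s'" "t = map Inl t'" "list_all2 (\<lambda>a b. (a, b) \<in> P) s' t'"
          "(a', b') \<in> P" "a = Inl a'" "b = Inl b'"
        by auto
      then show ?case
        by (intro exI[of _ "a' # s'"] exI[of _ "b' # t'"]) simp
    qed simp
    then show "s \<in> RQ i \<longleftrightarrow> t \<in> RQ i"
      using presD[OF P i] map_Inl_RQ by blast
  qed
qed

lemma spread_Inl: "Q.spread r (map_prod Inl Inl ` P) = map_prod Inl Inl ` spread r P"
proof -
  have "Q.spread r (map_prod Inl Inl ` P) =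
      {(fold nbrQ w (Inl a), fold nbrQ w (Inl b)) | w a b. w \<in> words r \<and> (a, b) \<in> P}"
    unfolding Q.spread_def by blast
  also have "\<dots> = map_prod Inl Inl ` spread r P"
    unfolding spread_def walk_Inl by (auto simp: image_iff)
  finally show ?thesis .
qed

lemma rich_Inl: "rich r U x \<Longrightarrow> Q.rich r (Inl ` U) (Inl x)"
proof -
  assume "rich r U x"
  then have "infinite (Inl ` {y \<in> U. pres (spread r {(x, y)})} :: ('a + nat) set)"
    unfolding rich_def by (simp add: finite_image_iff)
  moreover have "Q.pres (Q.spread r {(Inl x, Inl y)})" if "pres (spread r {(x, y)})" for y
    using that pres_Inl[of "spread r {(x, y)}"] spread_Inl[of r "{(x, y)}"] by simp
  then have "Inl ` {y \<in> U. pres (spread r {(x, y)})} \<subseteq> {y \<in> Inl ` U. Q.pres (Q.spread r {(Inl x, y)})}"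
    by blast
  ultimately show ?thesis
    unfolding Q.rich_def using finite_subset by blast
qed

text \<open>Only finitely many points reach a given point by walks of a fixed length, while the
  \<open>p n\<close> are pairwise distinct.\<close>

lemma infinite_walk_values:
  assumes w: "w \<in> W"
  shows "infinite ((\<lambda>n. fold nbr w (p n)) ` {n0..})"
proof
  assume "finite ((\<lambda>n. fold nbr w (p n)) ` {n0..})"
  then obtain m where inf: "infinite {n \<in> {n0..}. fold nbr w (p n) = fold nbr w (p m)}"
    using pigeonhole_infinite[OF infinite_Ici] by blast
  let ?y = "fold nbr w (p m)"
  have "p n \<in> (\<lambda>v. fold nbr v ?y) ` words (length w)" if n: "fold nbr w (p n) = ?y" for n
  proof -
    have "set w \<subseteq> {..<D}" using w by auto
    then obtain v where "set v \<subseteq> {..<D}" "length v = length w" "fold nbr v (fold nbr w (p n)) = p n"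
      using walk_back[OF p_in_U] by blast
    then show ?thesis
      using n by (intro image_eqI[of _ _ v]) (auto simp: words_def)
  qed
  then have "p ` {n \<in> {n0..}. fold nbr w (p n) = ?y} \<subseteq> (\<lambda>v. fold nbr v ?y) ` words (length w)"
    by blast
  then have "finite (p ` {n \<in> {n0..}. fold nbr w (p n) = ?y})"
    by (rule finite_subset) simp
  then show False
    using inf inj_p by (meson finite_imageD inj_on_subset subset_UNIV)
qed

lemma words_subset: "words r \<subseteq> W"
  unfolding words_def by auto

lemma map_append_lists: "w \<in> W \<Longrightarrow> set ws \<subseteq> W \<Longrightarrow> map ((@) w) ws \<in> lists W"
  by (induction ws) auto

text \<open>The r-profile of a new point involves finitely many conditions, and for large n all of
  them hold or fail as they do at the end of the walk \<open>w\<close> from \<open>p n\<close>.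
  These ends are infinitely many points of \<open>M\<close>.\<close>

lemma rich_emb:
  assumes w: "w \<in> W"
  shows "Q.rich r (Inl ` U) (emb j w)"
proof -
  let ?S = "Sigma I (\<lambda>i. {ws. set ws \<subseteq> words r \<and> length ws = ar i})"
  \<comment> \<open>An equivalence, because tuples that fail in the limit must also fail around the
    approximating point.\<close>
  let ?good = "\<lambda>n q. holds (fst q) (map ((@) w) (snd q)) \<longleftrightarrow>
      map (\<lambda>v. fold nbr v (fold nbr w (p n))) (snd q) \<in> R (fst q)"
  have "finite ?S"
    by (intro finite_SigmaI finite_I finite_lists_length_eq) auto
  moreover have "\<forall>\<^sub>F n in sequentially. ?good n q" if q: "q \<in> ?S" for q
  proof -
    have "map ((@) w) (snd q) \<in> lists W"
      using map_append_lists[OF w] q words_subset[of r] by (metis (no_types, lifting) SigmaE mem_Collect_eq snd_conv subset_trans)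
    then have "holds (fst q) (map ((@) w) (snd q)) \<or> (\<forall>\<^sub>F n in sequentially.
        map (\<lambda>w. fold nbr w (p n)) (map ((@) w) (snd q)) \<notin> R (fst q))"
      using q holds_dichotomy[of "fst q" "map ((@) w) (snd q)"] by auto
    then show ?thesis
    proof
      assume h: "holds (fst q) (map ((@) w) (snd q))"
      from h[unfolded holds_def] show ?thesis
        by eventually_elim (use h in \<open>simp add: o_def\<close>)
    next
      assume e: "\<forall>\<^sub>F n in sequentially. map (\<lambda>w. fold nbr w (p n)) (map ((@) w) (snd q)) \<notin> R (fst q)"
      have "\<not> holds (fst q) (map ((@) w) (snd q))"
      proof
        assume "holds (fst q) (map ((@) w) (snd q))"
        then have "\<forall>\<^sub>F n in sequentially. False"
          using e unfolding holds_def by eventually_elim blast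
        then show False by simp
      qed
      with e show ?thesis
        by (auto elim!: eventually_mono simp: o_def)
    qed
  qed
  ultimately have "\<forall>\<^sub>F n in sequentially. \<forall>q\<in>?S. ?good n q"
    by (intro eventually_ball_finite) blast+
  then obtain n0 where n0: "\<And>n. n \<ge> n0 \<Longrightarrow> \<forall>q\<in>?S. ?good n q"
    unfolding eventually_sequentially by blast
  have pres: "Q.pres (Q.spread r {(emb j w, Inl (fold nbr w (p n)))})" if n: "n \<ge> n0" for n
  proof (rule Q.same_profile_pres)
    have "map (\<lambda>v. fold nbrQ v (emb j w)) ws \<in> RQ i \<longleftrightarrow>
        map (\<lambda>v. fold nbrQ v (Inl (fold nbr w (p n)))) ws \<in> RQ i"
      if i: "i \<in> I" and ws: "set ws \<subseteq> words r" "length ws = ar i" for i ws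
    proof -
      have "map (\<lambda>v. fold nbrQ v (emb j w)) ws = map (emb j) (map ((@) w) ws)"
        using walk_emb[OF w, of _ j] subsetD[OF subset_trans[OF ws(1) words_subset]] by simp
      moreover have "map ((@) w) ws \<in> lists W"
        using map_append_lists[OF w] ws(1) words_subset by blast
      ultimately have "map (\<lambda>v. fold nbrQ v (emb j w)) ws \<in> RQ i \<longleftrightarrow> holds i (map ((@) w) ws)"
        using map_emb_RQ[OF i, of "map ((@) w) ws" j] by (simp only:)
      also have "\<dots> \<longleftrightarrow> map (\<lambda>v. fold nbr v (fold nbr w (p n))) ws \<in> R i"
        using n0[OF n] i ws by auto
      also have "\<dots> \<longleftrightarrow> map (\<lambda>v. fold nbrQ v (Inl (fold nbr w (p n)))) ws \<in> RQ i"
        using map_Inl_RQ[of "map (\<lambda>v. fold nbr v (fold nbr w (p n))) ws" i] by (simp add: walk_Inl o_def)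
      finally show ?thesis .
    qed
    then show "Q.profile r (emb j w) = Q.profile r (Inl (fold nbr w (p n)))"
      unfolding Q.profile_def by blast
  qed
  have "infinite ((Inl :: 'a \<Rightarrow> 'a + nat) ` (\<lambda>n. fold nbr w (p n)) ` {n0..})"
    using infinite_walk_values[OF w] by (simp add: finite_image_iff)
  moreover have "Inl ` (\<lambda>n. fold nbr w (p n)) ` {n0..} \<subseteq>
      {y \<in> Inl ` U. Q.pres (Q.spread r {(emb j w, y)})}"
    using pres walk_p_in_U[OF w] by auto
  ultimately show ?thesis
    unfolding Q.rich_def using finite_subset by blast
qed

section \<open>The copies of the limit component\<close>

definition copy :: "nat \<Rightarrow> ('a + nat) set" where
  "copy j = emb j ` W"

lemma comp_emb: "w \<in> W \<Longrightarrow> Q.comp (emb j w) = copy j"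
proof -
  have base: "Q.comp (emb j []) = copy j"
  proof -
    have "Q.comp (emb j []) = (\<lambda>v. fold nbrQ v (emb j [])) ` W"
      unfolding Q.comp_def lists_eq_set by blast
    also have "\<dots> = copy j"
      unfolding copy_def using walk_emb[of "[]" _ j] by simp
    finally show ?thesis .
  qed
  assume "w \<in> W"
  then have "emb j w \<in> Q.comp (emb j [])"
    unfolding base copy_def by blast
  then show ?thesis
    using Q.comp_eq[OF emb_in_UQ] base by blast
qed

lemma copy_disjoint: "j \<noteq> k \<Longrightarrow> copy j \<inter> copy k = {}"
  unfolding copy_def using emb_eq by blast

lemma copy_Inl: "copy j \<inter> Inl ` S = {}"
  unfolding copy_def by auto

lemma UQ_copies: "UQ = Inl ` U \<union> \<Union>(range copy)"
proof
  show "UQ \<subseteq> Inl ` U \<union> \<Union>(range copy)"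
    unfolding copy_def by (auto elim!: UQ_cases)
  show "Inl ` U \<union> \<Union>(range copy) \<subseteq> UQ"
    unfolding copy_def using UQ_def by auto
qed

text \<open>If finitely many words \<open>V\<close> represented all classes, then for large n the
  ends of the walks \<open>V\<close> from \<open>p n\<close> would form a set containing
  \<open>p n\<close> and closed under steps. The component of \<open>p n\<close> would have at most
  \<open>card V\<close> elements, against \<open>large\<close>.\<close>

lemma infinite_copy: "infinite (copy j)"
proof
  assume "finite (copy j)"
  then obtain V where V: "V \<subseteq> W" "finite V" "copy j = emb j ` V"
    unfolding copy_def using finite_subset_image[of "emb j ` W" "emb j" W] by blast
  have "\<forall>w\<in>W. \<exists>v\<in>V. sim w v"
  proof
    fix w assume w: "w \<in> W"
    then have "emb j w \<in> emb j ` V"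
      using V(3) unfolding copy_def by blast
    then obtain v where "v \<in> V" "emb j w = emb j v" by blast
    then show "\<exists>v\<in>V. sim w v"
      using emb_eq[OF w, of v j j] V(1) by blast
  qed
  then obtain c where c: "\<And>w. w \<in> W \<Longrightarrow> c w \<in> V" "\<And>w. w \<in> W \<Longrightarrow> sim w (c w)"
    by metis
  \<comment> \<open>Closure under single steps takes only finitely many identifications, so one n
    can satisfy them all.\<close>
  let ?Z = "insert [] ((\<lambda>(v, k). v @ [k]) ` (V \<times> {..<D}))"
  have ZW: "?Z \<subseteq> W"
    using V(1) by (auto dest!: subsetD)
  have "\<forall>\<^sub>F n in sequentially. \<forall>w\<in>?Z. fold nbr w (p n) = fold nbr (c w) (p n)"
  proof (rule eventually_ball_finite)
    show "finite ?Z" using V(2) by simp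
    show "\<forall>w\<in>?Z. \<forall>\<^sub>F n in sequentially. fold nbr w (p n) = fold nbr (c w) (p n)"
      using c(2) ZW unfolding sim_def by blast
  qed
  then have "\<forall>\<^sub>F n in sequentially. n > card V \<and> (\<forall>w\<in>?Z. fold nbr w (p n) = fold nbr (c w) (p n))"
    by (intro eventually_conj eventually_gt_at_top)
  then obtain n where n: "n > card V" "\<And>w. w \<in> ?Z \<Longrightarrow> fold nbr w (p n) = fold nbr (c w) (p n)"
    using eventually_happens'[OF sequentially_bot] by blast
  let ?S = "(\<lambda>v. fold nbr v (p n)) ` V"
  have "comp (p n) \<subseteq> ?S"
  proof (rule closed_imp_comp_subset)
    show "p n \<in> ?S"
      using n(2)[of "[]"] c(1)[of "[]"] by simp
    fix y k assume "y \<in> ?S" "k < D"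
    then obtain v where v: "v \<in> V" "y = fold nbr v (p n)" by blast
    have z: "v @ [k] \<in> ?Z" using v \<open>k < D\<close> by auto
    then have "nbr k y = fold nbr (c (v @ [k])) (p n)"
      using n(2)[OF z] v by simp
    then show "nbr k y \<in> ?S"
      using c(1) z ZW by blast
  qed
  then have "finite (comp (p n))" "card (comp (p n)) \<le> card V"
    using V(2) finite_subset card_mono[of ?S] card_image_le[OF V(2), of "\<lambda>v. fold nbr v (p n)"]
    by (blast, meson finite_imageI le_trans)
  then show False
    using large n(1) by fastforce
qed

text \<open>\<open>holds\<close> does not mention the copy number, so changing that number preserves
  all tuples.\<close>

lemma copy_transfer:
  "\<exists>f. (\<forall>x. f (Inl x) = Inl x) \<and> bij_betw f (copy j) (copy k) \<and>
    Q.pres ((\<lambda>z. (z, f z)) ` copy j)"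
proof -
  define g where "g z = (SOME w. w \<in> W \<and> z = emb j w)" for z
  define f where "f z = (if z \<in> copy j then emb k (g z) else z)" for z
  have f_emb: "f (emb j w) = emb k w" if w: "w \<in> W" for w
  proof -
    have "g (emb j w) \<in> W \<and> emb j w = emb j (g (emb j w))"
      unfolding g_def by (rule someI_ex) (use w in blast)
    then have "sim (g (emb j w)) w" "g (emb j w) \<in> W"
      using emb_eq[of "g (emb j w)" w j j] w by auto
    then show ?thesis
      unfolding f_def using w emb_eq[of "g (emb j w)" w k k] by (simp add: copy_def)
  qed
  have "f (Inl x) = Inl x" for x
    unfolding f_def using copy_Inl[of j UNIV] by auto
  moreover have "bij_betw f (copy j) (copy k)"
    unfolding bij_betw_def
  proof
    show "inj_on f (copy j)"
    proof (rule inj_onI)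
      fix a b assume "a \<in> copy j" "b \<in> copy j" and eq: "f a = f b"
      then obtain w v where w: "w \<in> W" "a = emb j w" and v: "v \<in> W" "b = emb j v"
        unfolding copy_def by blast
      then show "a = b"
        using eq f_emb emb_eq[OF w(1) v(1)] by metis
    qed
    show "f ` copy j = copy k"
      unfolding copy_def image_image using f_emb by simp
  qed
  moreover have "Q.pres ((\<lambda>z. (z, f z)) ` copy j)"
    unfolding Q.pres_def
  proof (intro ballI allI impI)
    fix i s t assume i: "i \<in> I" and l: "list_all2 (\<lambda>a b. (a, b) \<in> (\<lambda>z. (z, f z)) ` copy j) s t"
    from l have "\<exists>ws\<in>lists W. s = map (emb j) ws \<and> t = map (emb k) ws"
    proof (induction rule: list_all2_induct)
      case (Cons a s b t)
      then obtain ws w where "ws \<in> lists W" "s = map (emb j) ws" "t = map (emb k) ws"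
          "w \<in> W" "a = emb j w" "b = emb k w"
        using f_emb unfolding copy_def by blast
      then show ?case
        by (intro bexI[of _ "w # ws"]) simp_all
    qed simp
    then show "s \<in> RQ i \<longleftrightarrow> t \<in> RQ i"
      using map_emb_RQ[OF i] by blast
  qed
  ultimately show ?thesis
    by blast
qed

end

section \<open>Bounded components and cellularity\<close>

lemma set_zip_map: "set (zip xs (map f xs)) = (\<lambda>x. (x, f x)) ` set xs"
  by (induction xs) auto

text \<open>\<open>rel_pres\<close> is the form in which atomic \<open>L\<close>-formulas being
  boolean combinations over the basis is used: membership in an \<open>L\<close>-relation depends
  only on the type of the tuple with respect to \<open>R\<close>.\<close>

locale presented_structure =
  labelled_structure "univ M" I ar R eq D nbr
  for M :: "('r, 'a) struct" and I :: "'i set" and ar R eq D nbr +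
  fixes L :: "'r lang"
  assumes struct: "is_struct L M"
    and rel_pres: "r \<in> rels L \<Longrightarrow> length s = length t \<Longrightarrow> set s \<subseteq> univ M \<Longrightarrow> set t \<subseteq> univ M \<Longrightarrow>
      pres (set (zip s t)) \<Longrightarrow> s \<in> rel M r \<Longrightarrow> t \<in> rel M r"
begin

lemma rel_pres_iff:
  assumes "r \<in> rels L" "length s = length t" "set s \<subseteq> univ M" "set t \<subseteq> univ M" "pres (set (zip s t))"
  shows "s \<in> rel M r \<longleftrightarrow> t \<in> rel M r"
proof -
  have "set (zip t s) = (set (zip s t))\<inverse>"
    using assms(2) by (auto simp: set_zip)
  then have "pres (set (zip t s))"
    using assms(5) pres_converse by metis
  then show ?thesis
    using assms rel_pres[of r s t] rel_pres[of r t s] by auto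
qed

text \<open>A list meeting two components is no tuple, and neither is its image, since an injective
  map carrying components onto components keeps them apart. It serves both the automorphisms for
  cellularity and the isomorphisms between copies.\<close>

lemma glue_comps:
  assumes S: "S \<subseteq> univ M" "\<And>x. x \<in> S \<Longrightarrow> comp x \<subseteq> S" and inj: "inj_on f S" and f: "f ` S \<subseteq> univ M"
    and loc: "\<And>x. x \<in> S \<Longrightarrow> pres ((\<lambda>y. (y, f y)) ` comp x)"
    and im: "\<And>x. x \<in> S \<Longrightarrow> f ` comp x = comp (f x)"
  shows "pres ((\<lambda>y. (y, f y)) ` S)"
  unfolding pres_def
proof (intro ballI allI impI)
  fix i s t assume i: "i \<in> I" and l: "list_all2 (\<lambda>a b. (a, b) \<in> (\<lambda>y. (y, f y)) ` S) s t"
  have t: "t = map f s"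
    using l by (auto simp: list_all2_conv_all_nth intro!: nth_equalityI)
  have s: "set s \<subseteq> S"
    using l by (auto simp: list_all2_conv_all_nth set_conv_nth)
  show "s \<in> R i \<longleftrightarrow> t \<in> R i"
  proof (cases "s = []")
    case True
    then show ?thesis by (simp add: t)
  next
    case False
    then obtain x where x: "x \<in> set s" by (cases s) auto
    show ?thesis
    proof (cases "set s \<subseteq> comp x")
      case True
      then have "list_all2 (\<lambda>a b. (a, b) \<in> (\<lambda>y. (y, f y)) ` comp x) s t"
        unfolding t list_all2_conv_all_nth by (auto intro!: imageI subsetD[OF True])
      then show ?thesis
        using presD[OF loc i] x s by blast
    next
      case False
      then obtain y where y: "y \<in> set s" "y \<notin> comp x" by blast
      have "f y \<notin> comp (f x)"
      proof
        assume "f y \<in> comp (f x)"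
        then obtain z where "z \<in> comp x" "f z = f y"
          using im[of x] x s by (metis imageE subsetD)
        then show False
          using inj y S(2)[of x] x s by (metis inj_onD subsetD)
      qed
      then have "t \<notin> R i"
        using tuple_in_comp[OF i, of t "f x"] x y unfolding t by auto
      moreover have "s \<notin> R i"
        using tuple_in_comp[OF i _ x] False by blast
      ultimately show ?thesis by simp
    qed
  qed
qed

lemma rel_map_iff:
  assumes "pres ((\<lambda>y. (y, f y)) ` S)" "S \<subseteq> univ M" "f ` S \<subseteq> univ M" "r \<in> rels L" "set s \<subseteq> S"
  shows "s \<in> rel M r \<longleftrightarrow> map f s \<in> rel M r"
proof -
  have "set (zip s (map f s)) \<subseteq> (\<lambda>y. (y, f y)) ` S"
    using assms(5) by (auto simp: set_zip_map)
  then have "pres (set (zip s (map f s)))"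
    using assms(1) pres_mono by blast
  moreover have "set (map f s) \<subseteq> univ M"
    using assms(3,5) by auto
  ultimately show ?thesis
    using assms by (intro rel_pres_iff) auto
qed

text \<open>The type of an enumerated component. Positions replace points, so different components
  can be compared and bounded length leaves finitely many shapes.\<close>

definition shape :: "'a list \<Rightarrow> nat \<times> ('i \<times> nat list) set" where
  "shape l = (length l, {(i, js). i \<in> I \<and> length js = ar i \<and> set js \<subseteq> {..<length l} \<and>
    map ((!) l) js \<in> R i})"

lemma finite_shapes: "finite {shape l | l. length l \<le> b}"
proof -
  let ?S = "Sigma I (\<lambda>i. {js. set js \<subseteq> {..<b} \<and> length js = ar i})"
  have "finite ?S"
    by (intro finite_SigmaI finite_I finite_lists_length_eq) auto
  moreover have "{shape l | l. length l \<le> b} \<subseteq> {..b} \<times> Pow ?S"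
    unfolding shape_def by fastforce
  ultimately show ?thesis
    by (meson finite_Pow_iff finite_SigmaI finite_atMost finite_subset)
qed

lemma same_shape_pres:
  assumes "shape l = shape l'"
  shows "pres (set (zip l l'))"
  unfolding pres_def
proof (intro ballI allI impI)
  fix i s t assume i: "i \<in> I" and l: "list_all2 (\<lambda>a b. (a, b) \<in> set (zip l l')) s t"
  have len: "length l = length l'"
    using assms unfolding shape_def by simp
  have "\<forall>n<length s. \<exists>m<length l. s ! n = l ! m \<and> t ! n = l' ! m"
    using l len by (auto simp: list_all2_conv_all_nth set_zip)
  then obtain g where g: "\<And>n. n < length s \<Longrightarrow> g n < length l \<and> s ! n = l ! g n \<and> t ! n = l' ! g n"
    by metis
  define js where "js = map g [0..<length s]"
  have st: "s = map ((!) l) js" "t = map ((!) l') js"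
    using g l by (auto simp: js_def list_all2_conv_all_nth intro!: nth_equalityI)
  have "set js \<subseteq> {..<length l}"
    using g by (auto simp: js_def)
  then have "u \<in> {l, l'} \<Longrightarrow> (i, js) \<in> snd (shape u) \<longleftrightarrow> map ((!) u) js \<in> R i" for u
    unfolding shape_def using i len R_tuple[of i "map ((!) u) js"] by auto
  then show "s \<in> R i \<longleftrightarrow> t \<in> R i"
    using st assms by (metis insertCI)
qed

text \<open>Each shape realised by infinitely many components yields one family of tuples, the j-th
  tuple enumerating the j-th component of that shape. The remaining shapes account for finitely many
  finite components, whose union is \<open>K\<close>.\<close>

lemma bounded_comps_imp_cellular:
  assumes "countable (univ M)" and bnd: "\<And>x. x \<in> univ M \<Longrightarrow> finite (comp x) \<and> card (comp x) \<le> b"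
  shows "cellular L M"
proof -
  define CC where "CC = comp ` univ M"
  have CC_U: "E \<in> CC \<Longrightarrow> E \<subseteq> univ M" for E
    unfolding CC_def using comp_subset_U by auto
  have CC_comp: "E \<in> CC \<Longrightarrow> x \<in> E \<Longrightarrow> comp x = E" for E x
    unfolding CC_def using comp_eq by auto
  have CC_ne: "E \<in> CC \<Longrightarrow> E \<noteq> {}" for E
    unfolding CC_def using comp_self by auto
  have in_comp: "x \<in> univ M \<Longrightarrow> comp x \<in> CC" for x
    unfolding CC_def by auto
  have "E \<in> CC \<Longrightarrow> finite E" for E
    unfolding CC_def using bnd by auto
  then have "\<forall>E. \<exists>l. E \<in> CC \<longrightarrow> set l = E \<and> distinct l"
    by (metis finite_distinct_list)
  then obtain lst where lst: "\<And>E. E \<in> CC \<Longrightarrow> set (lst E) = E \<and> distinct (lst E)"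
    by metis
  define ty where "ty E = shape (lst E)" for E
  have len_ty: "ty E = ty E' \<Longrightarrow> length (lst E) = length (lst E')" for E E'
    unfolding ty_def shape_def by simp
  have "E \<in> CC \<Longrightarrow> length (lst E) \<le> b" for E
    using lst[of E] bnd distinct_card[of "lst E"] unfolding CC_def by fastforce
  then have fin_ty: "finite (ty ` CC)"
    by (intro finite_subset[OF _ finite_shapes[of b]]) (auto simp: ty_def)
  define pos where "pos l x = (SOME n. n < length l \<and> l ! n = x)" for l :: "'a list" and x
  have pos: "pos l (l ! n) = n" if "distinct l" "n < length l" for l n
    unfolding pos_def using that by (auto simp: nth_eq_iff_index_eq)
  \<comment> \<open>Turns a map \<open>g\<close> on components into a map on points: the entry of
    \<open>lst E\<close> at a given position goes to the entry of \<open>lst (g E)\<close> at that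
    position.\<close>
  define lift where "lift g x = lst (g (comp x)) ! pos (lst (comp x)) x" for g x
  have map_lift: "map (lift g) (lst E) = lst (g E)" if "E \<in> CC" "ty (g E) = ty E" for g E
  proof (rule nth_equalityI)
    show "length (map (lift g) (lst E)) = length (lst (g E))"
      using len_ty[OF that(2)] by simp
    fix n assume "n < length (map (lift g) (lst E))"
    then have n: "n < length (lst E)" by simp
    then have "comp (lst E ! n) = E"
      using CC_comp[OF that(1)] lst[OF that(1)] nth_mem by blast
    then show "map (lift g) (lst E) ! n = lst (g E) ! n"
      using n pos lst[OF that(1)] by (simp add: lift_def)
  qed
  have lift_image: "lift g ` E = g E" if "E \<in> CC" "g E \<in> CC" "ty (g E) = ty E" for g E
    using map_lift[of E g, OF that(1,3)] lst[OF that(1)] lst[OF that(2)] by (metis list.set_map)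
  have lift_fix: "lift g x = x" if x: "x \<in> univ M" and "g (comp x) = comp x" for g x
  proof -
    have "map (lift g) (lst (comp x)) = map id (lst (comp x))"
      using map_lift[OF in_comp[OF x], of g] that by simp
    then show ?thesis
      using lst[OF in_comp[OF x]] comp_self by (metis id_apply map_eq_conv)
  qed
  \<comment> \<open>Stated for a subset of the components, so that it covers both the local
    isomorphisms over \<open>K\<close> and the automorphisms.\<close>
  have lift_iso: "bij_betw (lift g) (\<Union>\<D>) (\<Union>(g ` \<D>)) \<and>
      (\<forall>r\<in>rels L. \<forall>t. set t \<subseteq> \<Union>\<D> \<longrightarrow> (t \<in> rel M r \<longleftrightarrow> map (lift g) t \<in> rel M r))"
    if D: "\<D> \<subseteq> CC" and g: "\<And>E. E \<in> \<D> \<Longrightarrow> g E \<in> CC \<and> ty (g E) = ty E" and inj: "inj_on g \<D>" for \<D> g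
  proof -
    have im: "lift g ` E = g E" if "E \<in> \<D>" for E
      using lift_image g that D by blast
    have U: "\<Union>\<D> \<subseteq> univ M"
      using D CC_U by auto
    have img: "lift g ` \<Union>\<D> = \<Union>(g ` \<D>)"
      using im by blast
    then have img_U: "lift g ` \<Union>\<D> \<subseteq> univ M"
      using g CC_U by blast
    have inj': "inj_on (lift g) (\<Union>\<D>)"
    proof (rule inj_onI)
      fix x y assume x: "x \<in> \<Union>\<D>" and y: "y \<in> \<Union>\<D>" and eq: "lift g x = lift g y"
      obtain E F where E: "E \<in> \<D>" "x \<in> E" and F: "F \<in> \<D>" "y \<in> F"
        using x y by auto
      have "lift g x \<in> g E" "lift g y \<in> g F"
        using im E F by blast+
      then have "g E = g F"
        using eq CC_comp g E F by metis
      then have EF: "E = F"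
        using inj E F by (auto dest: inj_onD)
      have EC: "E \<in> CC" using D E by auto
      obtain m n where mn: "m < length (lst E)" "x = lst E ! m" "n < length (lst E)" "y = lst E ! n"
        using lst[OF EC] E F EF by (metis in_set_conv_nth)
      have "lst (g E) ! m = lst (g E) ! n"
        using map_lift[OF EC, of g] g[OF E(1)] mn eq by (metis nth_map)
      moreover have "length (lst (g E)) = length (lst E)"
        using g[OF E(1)] len_ty by blast
      ultimately show "x = y"
        using lst g[OF E(1)] mn by (metis nth_eq_iff_index_eq)
    qed
    have "pres ((\<lambda>y. (y, lift g y)) ` \<Union>\<D>)"
    proof (rule glue_comps[OF U _ inj' img_U])
      fix x assume "x \<in> \<Union>\<D>"
      then obtain E where E: "E \<in> \<D>" "x \<in> E" by auto
      have EC: "E \<in> CC" using D E by auto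
      have cx: "comp x = E" using CC_comp[OF EC E(2)] .
      show "comp x \<subseteq> \<Union>\<D>" using cx E by auto
      show "lift g ` comp x = comp (lift g x)"
        using cx im[OF E(1)] CC_comp[of "g E" "lift g x"] g[OF E(1)] E(2) by auto
      have "(\<lambda>y. (y, lift g y)) ` comp x = set (zip (lst E) (map (lift g) (lst E)))"
        using lst[OF EC] cx by (simp add: set_zip_map)
      also have "\<dots> = set (zip (lst E) (lst (g E)))"
        using map_lift[OF EC, of g] g[OF E(1)] by simp
      finally show "pres ((\<lambda>y. (y, lift g y)) ` comp x)"
        using same_shape_pres g[OF E(1)] unfolding ty_def by metis
    qed
    then show ?thesis
      using rel_map_iff[OF _ U img_U] inj' img unfolding bij_betw_def by blast
  qed
  define BigTy where "BigTy = {\<tau> \<in> ty ` CC. infinite {E \<in> CC. ty E = \<tau>}}"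
  have "finite BigTy"
    unfolding BigTy_def using fin_ty by simp
  then obtain e n where e: "bij_betw e {..<n::nat} BigTy"
    using ex_bij_betw_nat_finite[of BigTy] unfolding atLeast0LessThan by blast
  define fiber where "fiber i = {E \<in> CC. ty E = e i}" for i
  have fiber_inf: "i < n \<Longrightarrow> infinite (fiber i)" for i
    unfolding fiber_def using e by (auto simp: BigTy_def bij_betw_def)
  have "countable CC"
    unfolding CC_def using assms(1) by simp
  then have "countable (fiber i)" for i
    unfolding fiber_def by (rule countable_subset[rotated]) auto
  then have enum: "i < n \<Longrightarrow> bij_betw (from_nat_into (fiber i)) UNIV (fiber i)" for i
    using fiber_inf bij_betw_from_nat_into by blast
  define en where "en i j = from_nat_into (fiber i) j" for i j
  have en_bij: "i < n \<Longrightarrow> bij_betw (en i) UNIV (fiber i)" for i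
    unfolding en_def using enum by blast
  have en_in: "i < n \<Longrightarrow> en i j \<in> fiber i" for i j
    using en_bij by (meson UNIV_I bij_betwE)
  have en_CC: "i < n \<Longrightarrow> en i j \<in> CC" and en_ty: "i < n \<Longrightarrow> ty (en i j) = e i" for i j
    using en_in unfolding fiber_def by auto
  have en_inj: "i < n \<Longrightarrow> i' < n \<Longrightarrow> en i j = en i' j' \<Longrightarrow> i = i' \<and> j = j'" for i i' j j'
  proof -
    assume a: "i < n" "i' < n" "en i j = en i' j'"
    then have "i = i'"
      using en_ty e by (metis bij_betw_iff_bijections lessThan_iff)
    then show "i = i' \<and> j = j'"
      using a en_bij by (metis UNIV_I bij_betw_imp_inj_on inj_onD)
  qed
  define Small where "Small = {E \<in> CC. ty E \<notin> BigTy}"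
  define K where "K = \<Union>Small"
  have "finite Small"
  proof -
    have "Small = (\<Union>\<tau>\<in>ty ` CC - BigTy. {E \<in> CC. ty E = \<tau>})"
      unfolding Small_def by auto
    also have "finite \<dots>"
      using fin_ty by (intro finite_UN_I) (auto simp: BigTy_def)
    finally show ?thesis .
  qed
  then have fin_K: "finite K"
    unfolding K_def Small_def using bnd by (auto simp: CC_def)
  define c where "c i j = lst (en i j)" for i j
  have set_c: "i < n \<Longrightarrow> set (c i j) = en i j" and dist_c: "i < n \<Longrightarrow> distinct (c i j)" for i j
    unfolding c_def using lst en_CC by auto
  have CC_cases: "E \<in> CC \<Longrightarrow> E \<in> Small \<or> (\<exists>i<n. \<exists>j. E = en i j)" for E
  proof -
    assume E: "E \<in> CC"
    show ?thesis
    proof (cases "E \<in> Small")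
      case False
      then have "ty E \<in> BigTy" using E unfolding Small_def by auto
      then obtain i where i: "i < n" "ty E = e i"
        using e by (metis bij_betw_iff_bijections lessThan_iff)
      then have "E \<in> fiber i" unfolding fiber_def using E by auto
      then show ?thesis
        using en_bij[OF i(1)] i by (metis UNIV_I bij_betw_iff_bijections)
    qed auto
  qed
  have en_not_Small: "i < n \<Longrightarrow> en i j \<notin> Small" for i j
    unfolding Small_def using en_ty e by (auto simp: bij_betw_def)
  have CC_disj: "E \<in> CC \<Longrightarrow> F \<in> CC \<Longrightarrow> E \<noteq> F \<Longrightarrow> E \<inter> F = {}" for E F
    using CC_comp by blast
  have K_disj: "set (c i j) \<inter> K = {}" if i: "i < n" for i j
  proof -
    have "en i j \<inter> E = {}" if E: "E \<in> Small" for E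
    proof (rule CC_disj[OF en_CC[OF i]])
      show "E \<in> CC" using E unfolding Small_def by simp
      show "en i j \<noteq> E" using E en_not_Small[OF i, of j] by blast
    qed
    then show ?thesis
      unfolding set_c[OF i] K_def by blast
  qed
  have univ: "univ M = K \<union> (\<Union>i<n. \<Union>j. set (c i j))"
  proof
    show "univ M \<subseteq> K \<union> (\<Union>i<n. \<Union>j. set (c i j))"
    proof
      fix x assume "x \<in> univ M"
      then have "comp x \<in> Small \<or> (\<exists>i<n. \<exists>j. comp x = en i j)"
        using CC_cases in_comp by blast
      then show "x \<in> K \<union> (\<Union>i<n. \<Union>j. set (c i j))"
        using comp_self[of x] set_c unfolding K_def by fastforce
    qed
    show "K \<union> (\<Union>i<n. \<Union>j. set (c i j)) \<subseteq> univ M"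
      using CC_U en_CC set_c unfolding K_def Small_def by fastforce
  qed
  show ?thesis
    unfolding cellular_def
  proof (intro exI conjI)
    show "finite K" by (rule fin_K)
    show "univ M = K \<union> (\<Union>i<n. \<Union>j. set (c i j))" by (rule univ)
    show "\<forall>i<n. 0 < (\<lambda>i. length (c i 0)) i"
      using set_c CC_ne en_CC by (metis length_greater_0_conv list.set(1))
    show "\<forall>i<n. \<forall>j. length (c i j) = (\<lambda>i. length (c i 0)) i \<and> distinct (c i j) \<and> set (c i j) \<inter> K = {}"
      using dist_c K_disj len_ty en_ty unfolding c_def by metis
    show "\<forall>i<n. \<forall>i'<n. \<forall>j j'. (i, j) \<noteq> (i', j') \<longrightarrow> set (c i j) \<inter> set (c i' j') = {}"
      using set_c CC_disj en_CC en_inj by (metis (no_types, lifting))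
    show "\<forall>i<n. \<forall>j j'. \<exists>f. (\<forall>x\<in>K. f x = x) \<and> map f (c i j) = c i j' \<and>
        isomorphism L f (induced M (K \<union> set (c i j))) (induced M (K \<union> set (c i j')))"
    proof (intro allI impI)
      fix i j j' assume i: "i < n"
      \<comment> \<open>For distinct \<open>j\<close> and \<open>j'\<close> this is not injective on
        all components, only on those of \<open>K\<close> together with \<open>en i j\<close>, which
        suffices here.\<close>
      define g where "g = id(en i j := en i j')"
      have g_Small: "E \<in> Small \<Longrightarrow> g E = E" for E
        unfolding g_def using en_not_Small[OF i] by auto
      let ?D = "insert (en i j) Small"
      have D: "?D \<subseteq> CC"
        unfolding Small_def using en_CC[OF i] by auto
      have im: "\<Union>(g ` ?D) = K \<union> set (c i j')"
      proof -
        have "g ` Small = Small"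
          using g_Small by simp
        then show ?thesis
          unfolding image_insert K_def set_c[OF i] by (simp add: g_def Un_commute)
      qed
      have UD: "\<Union>?D = K \<union> set (c i j)"
        using set_c[OF i] by (auto simp: K_def)
      have iso: "bij_betw (lift g) (\<Union>?D) (\<Union>(g ` ?D)) \<and>
          (\<forall>r\<in>rels L. \<forall>t. set t \<subseteq> \<Union>?D \<longrightarrow> (t \<in> rel M r \<longleftrightarrow> map (lift g) t \<in> rel M r))"
      proof (rule lift_iso[OF D])
        show "g E \<in> CC \<and> ty (g E) = ty E" if "E \<in> ?D" for E
          using that D en_CC[OF i] en_ty[OF i] by (auto simp: g_def)
        show "inj_on g ?D"
          using en_not_Small[OF i] by (auto simp: g_def inj_on_def)
      qed
      have sub: "K \<union> set (c i j) \<subseteq> univ M" "K \<union> set (c i j') \<subseteq> univ M"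
        using univ i by auto
      have m: "map (lift g) t \<in> rel M r \<Longrightarrow> set t \<subseteq> K \<union> set (c i j) \<Longrightarrow> lift g ` set t \<subseteq> K \<union> set (c i j')"
        for t r
        using iso unfolding im UD bij_betw_def by blast
      have "isomorphism L (lift g) (induced M (K \<union> set (c i j))) (induced M (K \<union> set (c i j')))"
        using iso sub m unfolding im UD isomorphism_def induced_def
        by (simp add: Int_absorb1) blast
      moreover have "map (lift g) (c i j) = c i j'"
        using map_lift[OF en_CC[OF i], of g j] en_ty[OF i] by (simp add: g_def c_def)
      moreover have "\<forall>x\<in>K. lift g x = x"
      proof
        fix x assume "x \<in> K"
        then obtain E where E: "E \<in> Small" "x \<in> E" unfolding K_def by auto
        then have "comp x = E" "x \<in> univ M"
          using CC_comp CC_U unfolding Small_def by auto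
        then show "lift g x = x"
          using lift_fix g_Small E by simp
      qed
      ultimately show "\<exists>f. (\<forall>x\<in>K. f x = x) \<and> map f (c i j) = c i j' \<and>
        isomorphism L f (induced M (K \<union> set (c i j))) (induced M (K \<union> set (c i j')))"
        by blast
    qed
    show "\<forall>i<n. \<forall>\<sigma> :: nat \<Rightarrow> nat. bij \<sigma> \<longrightarrow>
           (\<exists>f. isomorphism L f M M \<and> (\<forall>j. map f (c i j) = c i (\<sigma> j)) \<and>
                (\<forall>x \<in> univ M - (\<Union>j. set (c i j)). f x = x))"
    proof (intro allI impI)
      fix i and \<sigma> :: "nat \<Rightarrow> nat" assume i: "i < n" and \<sigma>: "bij \<sigma>"
      define g where "g E = (if E \<in> fiber i then en i (\<sigma> (inv (en i) E)) else E)" for E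
      have "inj (en i)"
        using en_bij[OF i] by (simp add: bij_betw_def)
      then have g_en: "g (en i j) = en i (\<sigma> j)" for j
        unfolding g_def using en_in[OF i] by simp
      have fib: "E \<in> fiber i \<Longrightarrow> \<exists>j. E = en i j" for E
        using en_bij[OF i] by (metis UNIV_I bij_betw_iff_bijections)
      have g_other: "E \<notin> fiber i \<Longrightarrow> g E = E" for E
        unfolding g_def by simp
      have g_img: "g ` CC = CC"
      proof
        show "g ` CC \<subseteq> CC"
          using fib g_en g_other en_CC[OF i] by (metis image_subsetI)
        show "CC \<subseteq> g ` CC"
        proof
          fix E assume E: "E \<in> CC"
          show "E \<in> g ` CC"
          proof (cases "E \<in> fiber i")
            case True
            then obtain j where "E = en i j" using fib by auto
            then have "E = g (en i (inv \<sigma> j))"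
              using g_en \<sigma> by (metis bij_inv_eq_iff)
            then show ?thesis using en_CC[OF i] by blast
          next
            case False
            then show ?thesis using g_other E by (metis imageI)
          qed
        qed
      qed
      have UCC: "\<Union>CC = univ M"
        using CC_U in_comp comp_self by blast
      have iso: "bij_betw (lift g) (\<Union>CC) (\<Union>(g ` CC)) \<and>
          (\<forall>r\<in>rels L. \<forall>t. set t \<subseteq> \<Union>CC \<longrightarrow> (t \<in> rel M r \<longleftrightarrow> map (lift g) t \<in> rel M r))"
      proof (rule lift_iso[OF subset_refl])
        show "g E \<in> CC \<and> ty (g E) = ty E" if E: "E \<in> CC" for E
          using fib[of E] g_en g_other[of E] en_CC[OF i] en_ty[OF i] E by (metis)
        show "inj_on g CC"
        proof (rule inj_onI)
          fix E F assume "g E = g F"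
          moreover have "g E \<in> fiber i \<longleftrightarrow> E \<in> fiber i" for E
            using fib g_en g_other en_in[OF i] by metis
          ultimately show "E = F"
            using fib g_en g_other en_inj[OF i i] \<sigma> by (metis bij_pointE)
        qed
      qed
      have "isomorphism L (lift g) M M"
        using iso unfolding isomorphism_def g_img UCC by auto
      moreover have "map (lift g) (c i j) = c i (\<sigma> j)" for j
        using map_lift[OF en_CC[OF i], of g j] en_ty[OF i] g_en by (simp add: c_def)
      moreover have "lift g x = x" if x: "x \<in> univ M - (\<Union>j. set (c i j))" for x
      proof -
        have "comp x \<notin> fiber i"
          using fib x comp_self[of x] set_c[OF i] by fastforce
        then show ?thesis
          using lift_fix[of x g] g_other x by simp
      qed
      ultimately show "\<exists>f. isomorphism L f M M \<and> (\<forall>j. map f (c i j) = c i (\<sigma> j)) \<and>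
                (\<forall>x \<in> univ M - (\<Union>j. set (c i j)). f x = x)"
        by blast
    qed
  qed
qed

end

section \<open>The elementary extension\<close>

lemma finite_fv: "finite (fv \<phi>)"
proof (induction \<phi>)
  case (Rel r ts)
  have "finite (tm_vars t)" for t :: "'b tm"
    by (cases t) auto
  then show ?case by simp
next
  case (Eq s t)
  then show ?case by (cases s; cases t) auto
qed auto

lemma finite_fm_consts: "finite (fm_consts \<phi>)"
proof (induction \<phi>)
  case (Rel r ts)
  have "finite (tm_consts t)" for t :: "'b tm"
    by (cases t) auto
  then show ?case by simp
next
  case (Eq s t)
  then show ?case by (cases s; cases t) auto
qed auto

lemma tm_val_cong: "(\<And>v. v \<in> tm_vars t \<Longrightarrow> e v = e' v) \<Longrightarrow> tm_val \<kappa> e t = tm_val \<kappa> e' t"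
  by (cases t) auto

lemma sat_cong: "(\<And>v. v \<in> fv \<phi> \<Longrightarrow> e v = e' v) \<Longrightarrow> sat M \<kappa> e \<phi> \<longleftrightarrow> sat M \<kappa> e' \<phi>"
proof (induction \<phi> arbitrary: e e')
  case (Rel r ts)
  then have "map (tm_val \<kappa> e) ts = map (tm_val \<kappa> e') ts"
    by (intro map_cong refl tm_val_cong) auto
  then show ?case by (simp only: sat.simps)
next
  case (Eq s t)
  then have "tm_val \<kappa> e s = tm_val \<kappa> e' s" "tm_val \<kappa> e t = tm_val \<kappa> e' t"
    by (auto intro!: tm_val_cong)
  then show ?case by simp
next
  case (Neg \<phi>)
  have "sat M \<kappa> e \<phi> \<longleftrightarrow> sat M \<kappa> e' \<phi>"
    by (rule Neg.IH) (simp add: Neg.prems)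
  then show ?case by simp
next
  case (And \<phi> \<psi>)
  have "sat M \<kappa> e \<phi> \<longleftrightarrow> sat M \<kappa> e' \<phi>" "sat M \<kappa> e \<psi> \<longleftrightarrow> sat M \<kappa> e' \<psi>"
    by (rule And.IH, simp add: And.prems)+
  then show ?case by simp
next
  case (Ex v \<phi>)
  have "sat M \<kappa> (e(v := x)) \<phi> \<longleftrightarrow> sat M \<kappa> (e'(v := x)) \<phi>" for x
  proof (rule Ex.IH)
    fix u assume "u \<in> fv \<phi>"
    then show "(e(v := x)) u = (e'(v := x)) u"
      using Ex.prems[of u] by (cases "u = v") simp_all
  qed
  then show ?case by simp
qed simp

lemma map_in_defined_rel:
  assumes "range e \<subseteq> univ M"
  shows "map e (sorted_list_of_set (fv \<phi>)) \<in> defined_rel M \<kappa> \<phi> \<longleftrightarrow> sat M \<kappa> e \<phi>"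
proof
  assume "map e (sorted_list_of_set (fv \<phi>)) \<in> defined_rel M \<kappa> \<phi>"
  then obtain e' where "map e (sorted_list_of_set (fv \<phi>)) = map e' (sorted_list_of_set (fv \<phi>))"
      "sat M \<kappa> e' \<phi>"
    unfolding defined_rel_def by blast
  then show "sat M \<kappa> e \<phi>"
    using sat_cong[of \<phi> e e'] finite_fv[of \<phi>] by simp
qed (use assms in \<open>auto simp: defined_rel_def\<close>)

text \<open>Valuations are total; \<open>u\<close> is the value for variables outside
  \<open>xs\<close>.\<close>

lemma ex_valuation:
  assumes "distinct xs" "length xs = length t"
  shows "\<exists>e. map e xs = t \<and> range e \<subseteq> insert u (set t)"
  using assms(2,1)
proof (induction rule: list_induct2)
  case Nil
  then show ?case by (intro exI[of _ "\<lambda>_. u"]) auto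
next
  case (Cons x xs y t)
  then obtain e where e: "map e xs = t" "range e \<subseteq> insert u (set t)" by auto
  have "map (e(x := y)) (x # xs) = y # t"
    using Cons.prems e(1) by simp
  moreover have "range (e(x := y)) \<subseteq> insert u (set (y # t))"
    using e(2) by auto
  ultimately show ?case by (intro exI[of _ "e(x := y)"] conjI)
qed

text \<open>The quantifier clause is the loss of radius in \<open>extend_pres\<close>.\<close>

primrec radius :: "('r, 'c) fm \<Rightarrow> nat" where
  "radius Falsum = 0"
| "radius (Rel r ts) = 0"
| "radius (Eq s t) = 0"
| "radius (Neg \<phi>) = radius \<phi>"
| "radius (And \<phi> \<psi>) = max (radius \<phi>) (radius \<psi>)"
| "radius (Ex v \<phi>) = 3 * radius \<phi> + 1"

locale elementary_limit =
  presented_structure M I ar R eq D nbr L + limit_component "univ M" I ar R eq D nbr p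
  for M :: "('r, 'a) struct" and I :: "'i set" and ar R eq D nbr and L :: "'r lang" and p
begin

text \<open>
  The \<open>L\<close>-relations are transported along quantifier-free types: every tuple of \<open>UQ\<close> has the same
  \<open>RQ\<close>-type as some tuple of \<open>M\<close>.
\<close>

definition N :: "('r, 'a + nat) struct" where
  "N = \<lparr>univ = UQ, rel = (\<lambda>r. {t. set t \<subseteq> UQ \<and>
     (\<exists>s\<in>rel M r. length s = length t \<and> Q.pres (set (zip t (map Inl s))))})\<rparr>"

lemma univ_N [simp]: "univ N = UQ"
  by (simp add: N_def)

lemma rel_M: "r \<in> rels L \<Longrightarrow> s \<in> rel M r \<Longrightarrow> length s = arity L r \<and> set s \<subseteq> univ M"
  using struct unfolding is_struct_def by blast

lemma struct_N: "is_struct L N"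
  unfolding is_struct_def
proof (intro conjI ballI)
  show "univ N \<noteq> {}"
    by (auto simp: UQ_def)
  fix r t assume "r \<in> rels L" "t \<in> rel N r"
  then show "length t = arity L r" "set t \<subseteq> univ N"
    using rel_M unfolding N_def by auto
qed

lemma rel_N_pres:
  assumes "length s = length t" "set t \<subseteq> UQ" "Q.pres (set (zip s t))" "s \<in> rel N r"
  shows "t \<in> rel N r"
proof -
  obtain u where u: "u \<in> rel M r" "length u = length s" "Q.pres (set (zip s (map Inl u)))"
    using assms(4) unfolding N_def by auto
  have "set (zip t (map Inl u)) \<subseteq> (set (zip s t))\<inverse> O set (zip s (map Inl u))"
  proof
    fix q assume "q \<in> set (zip t (map Inl u))"
    then obtain n where n: "n < length t" "n < length u" "q = (t ! n, map Inl u ! n)"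
      unfolding set_zip by auto
    then have "(s ! n, t ! n) \<in> set (zip s t)" "(s ! n, map Inl u ! n) \<in> set (zip s (map Inl u))"
      unfolding set_zip using assms(1) by auto
    then show "q \<in> (set (zip s t))\<inverse> O set (zip s (map Inl u))"
      using n by blast
  qed
  moreover have "Q.pres ((set (zip s t))\<inverse> O set (zip s (map Inl u)))"
    using assms(3) u(3) by (intro Q.pres_comp) (simp_all add: Q.pres_converse)
  ultimately have "Q.pres (set (zip t (map Inl u)))"
    using Q.pres_mono by blast
  then show ?thesis
    unfolding N_def using u assms by auto
qed

text \<open>Makes \<open>glue_comps\<close> and \<open>rel_map_iff\<close> available for the
  extension.\<close>

sublocale NP: presented_structure N I ar RQ eq D nbrQ L
  unfolding presented_structure_def presented_structure_axioms_def univ_N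
  using Q.labelled_structure_axioms struct_N rel_N_pres by blast

lemma zip_map_Inl: "set (zip (map Inl s) (map Inl t)) = map_prod Inl Inl ` set (zip s t)"
  by (simp add: zip_map_map image_def map_prod_def)

text \<open>The tuple witnessing \<open>map Inl t\<close> may differ from \<open>t\<close>, but it
  has the same type, so \<open>rel_pres_iff\<close> carries membership over.\<close>

lemma rel_N_Inl:
  assumes "r \<in> rels L" "set t \<subseteq> univ M"
  shows "map Inl t \<in> rel N r \<longleftrightarrow> t \<in> rel M r"
proof
  assume "map Inl t \<in> rel N r"
  then obtain s where s: "s \<in> rel M r" "length s = length t" "Q.pres (set (zip (map Inl t) (map Inl s)))"
    unfolding N_def by auto
  then have "pres (set (zip t s))"
    unfolding zip_map_Inl pres_Inl by blast
  then show "t \<in> rel M r"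
    using rel_pres_iff[of r t s] s assms rel_M by auto
next
  assume t: "t \<in> rel M r"
  have "Q.pres (set (zip (map Inl t) (map Inl t)))"
    by (rule Q.pres_Id) (auto simp: set_zip)
  then show "map Inl t \<in> rel N r"
    unfolding N_def UQ_def using t assms by auto
qed

text \<open>All radii below \<open>k\<close> are taken together because later rounds of the game
  need richness at smaller radii.\<close>

definition exceptions :: "nat \<Rightarrow> 'a set" where
  "exceptions k = (\<Union>r\<in>{..<k}. {x \<in> univ M. \<not> rich r (univ M) x})"

lemma exceptions: "finite (exceptions k)" "exceptions k \<subseteq> univ M"
  unfolding exceptions_def using finite_exceptions by auto

lemma rich_outside_exceptions:
  assumes "x \<in> UQ" "x \<notin> Inl ` exceptions k" "r < k"
  shows "Q.rich r (Inl ` univ M) x"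
  using assms(1)
proof (rule UQ_cases)
  fix a assume "a \<in> univ M" "x = Inl a"
  then show ?thesis
    using assms rich_Inl unfolding exceptions_def by blast
qed (simp add: rich_emb)

text \<open>The game with all answers in \<open>M\<close>. Adding a point costs a passage from
  \<open>r\<close> to 3r + 1 and requires its exceptions to be fixed beforehand, so the induction
  keeps both \<open>r\<close> and \<open>F\<close> free.\<close>

lemma approximate_in_M:
  assumes "finite X" "X \<subseteq> UQ" "finite F" "F \<subseteq> univ M"
  shows "\<exists>h. h ` X \<subseteq> univ M \<and> Q.pres (Q.spread r ((\<lambda>x. (x, Inl (h x))) ` X \<union> Id_on (Inl ` F)))"
  using assms
proof (induction X arbitrary: r F rule: finite_induct)
  case empty
  then show ?case using Q.pres_spread_Id_on by simp
next
  case (insert x X)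
  \<comment> \<open>\<open>Suc r\<close>, since \<open>exceptions\<close> deals with radii strictly
    below its argument.\<close>
  let ?F = "F \<union> exceptions (Suc r)"
  obtain h where h: "h ` X \<subseteq> univ M"
      "Q.pres (Q.spread (3 * r + 1) ((\<lambda>x. (x, Inl (h x))) ` X \<union> Id_on (Inl ` ?F)))"
    using insert.IH[of ?F "3 * r + 1"] insert.prems exceptions by auto
  let ?P = "(\<lambda>x. (x, Inl (h x))) ` X \<union> Id_on (Inl ` ?F)"
  have Inl_UQ: "Inl a \<in> UQ" if "a \<in> univ M" for a
    using that by (simp add: UQ_def)
  have Id_fin: "finite (Id_on (Inl ` ?F))"
    using insert.prems exceptions by (simp add: Id_on_def)
  have P: "finite ?P" "?P \<subseteq> UQ \<times> UQ"
    using insert.hyps insert.prems exceptions(2)[of "Suc r"] h(1) Inl_UQ Id_fin by auto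
  have rng: "b \<in> Inl ` univ M" if "(a, b) \<in> ?P" for a b
    using that h(1) insert.prems exceptions(2)[of "Suc r"] by auto
  obtain y where y: "y \<in> UQ" "Q.pres (Q.spread r (insert (x, y) ?P))"
      "y \<in> Inl ` univ M \<or> (\<exists>w a b. (a, b) \<in> ?P \<and> set w \<subseteq> {..<D} \<and> y = fold nbrQ w b)"
  proof (rule Q.extend_pres[OF P h(2), of x "Inl ` univ M"])
    show "x \<in> UQ" using insert.prems by simp
    show "Inl ` univ M \<subseteq> UQ" by (simp add: UQ_def)
    assume "(x, x) \<notin> ?P"
    then have "x \<notin> Inl ` exceptions (Suc r)" by blast
    then show "Q.rich r (Inl ` univ M) x"
      using insert.prems by (intro rich_outside_exceptions[of x "Suc r"]) auto
  qed
  \<comment> \<open>An answer to a near point is reached by a walk from an earlier answer, and walks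
    never leave \<open>M\<close>.\<close>
  have "y \<in> Inl ` univ M"
    using y(3)
  proof
    assume "\<exists>w a b. (a, b) \<in> ?P \<and> set w \<subseteq> {..<D} \<and> y = fold nbrQ w b"
    then obtain w a b where w: "(a, b) \<in> ?P" "set w \<subseteq> {..<D}" "y = fold nbrQ w b"
      by (elim exE conjE)
    from rng[OF w(1)] obtain b' where "b' \<in> univ M" "b = Inl b'"
      by (rule imageE)
    then show ?thesis
      using w(2,3) by (simp add: walk_Inl walk_in_U)
  qed
  then obtain y' where y': "y' \<in> univ M" "y = Inl y'" by blast
  let ?h = "h(x := y')"
  have "(\<lambda>z. (z, Inl (?h z))) ` insert x X \<union> Id_on (Inl ` F) \<subseteq> insert (x, y) ?P"
    using insert.hyps(2) y' by auto
  then have "Q.pres (Q.spread r ((\<lambda>z. (z, Inl (?h z))) ` insert x X \<union> Id_on (Inl ` F)))"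
    by (rule Q.pres_spread_mono[OF y(2)]) simp
  moreover have "?h ` insert x X \<subseteq> univ M"
    using h(1) y' by auto
  ultimately show ?case by blast
qed

text \<open>The hypotheses under which the duplicator wins the Ehrenfeucht--Fraisse game for \<open>\<phi>\<close>.\<close>

definition matching :: "('r, 'a) fm \<Rightarrow> (('a + nat) \<times> ('a + nat)) set \<Rightarrow>
    (nat \<Rightarrow> 'a + nat) \<Rightarrow> (nat \<Rightarrow> 'a + nat) \<Rightarrow> bool" where
  "matching \<phi> P e e' \<longleftrightarrow> finite P \<and> P \<subseteq> UQ \<times> UQ \<and> Q.pres (Q.spread (radius \<phi>) P) \<and>
     Id_on (Inl ` fm_consts \<phi>) \<subseteq> P \<and> (\<forall>v\<in>fv \<phi>. (e v, e' v) \<in> P) \<and>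
     (\<forall>x\<in>UQ. (x, x) \<notin> P \<longrightarrow> (\<forall>r<radius \<phi>. Q.rich r (Inl ` univ M) x))"

lemma matching_converse: "matching \<phi> P e e' \<Longrightarrow> matching \<phi> (P\<inverse>) e' e"
  unfolding matching_def by (auto simp: Q.spread_converse Q.pres_converse)

lemma matching_tm:
  assumes "tm_vars t \<subseteq> fv \<phi>" "tm_consts t \<subseteq> fm_consts \<phi>" "matching \<phi> P e e'"
  shows "(tm_val Inl e t, tm_val Inl e' t) \<in> P"
  using assms unfolding matching_def by (cases t) auto

text \<open>Atomic formulas are settled by preservation at radius 0; a quantifier is one move,
  answered by \<open>extend_pres\<close>.\<close>

lemma sat_matching:
  "well_formed L \<phi> \<Longrightarrow> matching \<phi> P e e' \<Longrightarrow> sat N Inl e \<phi> \<longleftrightarrow> sat N Inl e' \<phi>"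
proof (induction \<phi> arbitrary: P e e')
  case Falsum
  then show ?case by simp
next
  case (Rel r ts)
  have P: "Q.pres P" "P \<subseteq> UQ \<times> UQ"
    using Rel.prems unfolding matching_def by simp_all
  have ts: "(tm_val Inl e t, tm_val Inl e' t) \<in> P" if "t \<in> set ts" for t
    using that Rel.prems(2) by (intro matching_tm[of t "Rel r ts"]) auto
  then have zip: "set (zip (map (tm_val Inl e) ts) (map (tm_val Inl e') ts)) \<subseteq> P"
    by (auto simp: zip_map_map zip_same_conv_map)
  moreover have "tm_val Inl e t \<in> UQ \<and> tm_val Inl e' t \<in> UQ" if "t \<in> set ts" for t
    using ts[OF that] P(2) by blast
  ultimately show ?case
    using NP.rel_pres_iff[of r "map (tm_val Inl e) ts" "map (tm_val Inl e') ts"] Rel.prems(1)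
      Q.pres_mono[OF P(1)] by auto
next
  case (Eq s t)
  have P: "Q.pres P" "P \<subseteq> UQ \<times> UQ"
    using Eq.prems unfolding matching_def by simp_all
  have st: "(tm_val Inl e s, tm_val Inl e' s) \<in> P" "(tm_val Inl e t, tm_val Inl e' t) \<in> P"
    using Eq.prems(2) by (auto intro: matching_tm[of _ "Eq s t"])
  then have "[tm_val Inl e s, tm_val Inl e t] \<in> RQ eq \<longleftrightarrow> [tm_val Inl e' s, tm_val Inl e' t] \<in> RQ eq"
    by (intro Q.presD[OF P(1) eq_in]) simp
  moreover have "tm_val Inl e s \<in> UQ" "tm_val Inl e' s \<in> UQ"
    using st(1) P(2) by blast+
  ultimately show ?case
    unfolding Q.pair_in_eq by simp
next
  case (Neg \<phi>)
  then have "matching \<phi> P e e'"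
    unfolding matching_def by simp
  then show ?case using Neg by simp
next
  case (And \<phi> \<psi>)
  then have "matching \<phi> P e e'" "matching \<psi> P e e'"
    unfolding matching_def by (auto elim: Q.pres_spread_mono simp: less_max_iff_disj)
  then show ?case using And by simp
next
  case (Ex v \<phi>)
  \<comment> \<open>\<open>P\<close>, \<open>e\<close> and \<open>e'\<close> are arbitrary so that
    the converse relation gives the other implication.\<close>
  have "sat N Inl e' (Ex v \<phi>)" if m: "matching (Ex v \<phi>) P e e'" and s: "sat N Inl e (Ex v \<phi>)" for P e e'
  proof -
    obtain x where x: "x \<in> UQ" "sat N Inl (e(v := x)) \<phi>"
      using s by auto
    have P: "finite P" "P \<subseteq> UQ \<times> UQ" "Q.pres (Q.spread (3 * radius \<phi> + 1) P)"
      using m unfolding matching_def by auto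
    obtain y where y: "y \<in> UQ" "Q.pres (Q.spread (radius \<phi>) (insert (x, y) P))"
    proof (rule Q.extend_pres[OF P x(1), of "Inl ` univ M"])
      show "Inl ` univ M \<subseteq> UQ"
        unfolding UQ_def by blast
      show "Q.rich (radius \<phi>) (Inl ` univ M) x" if "(x, x) \<notin> P"
        using m x(1) that unfolding matching_def by simp
    qed
    have "matching \<phi> (insert (x, y) P) (e(v := x)) (e'(v := y))"
      using m x(1) y unfolding matching_def by auto
    then have "sat N Inl (e'(v := y)) \<phi>"
      using Ex.IH[of "insert (x, y) P"] Ex.prems(1) x(2) by simp
    then show ?thesis using y(1) by auto
  qed
  from this[of P e e'] this[of "P\<inverse>" e' e] show ?case
    using Ex.prems(2) matching_converse by blast
qed

text \<open>\<open>X\<close> is moved into \<open>M\<close> while \<open>S\<close> stays fixed. The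
  uses are a single witness beside fixed parameters, and a whole tuple with nothing fixed.\<close>

lemma approximate_sat:
  assumes \<phi>: "\<phi> \<in> formulas L (univ M)" and X: "finite X" "X \<subseteq> UQ" and S: "finite S" "S \<subseteq> univ M"
  shows "\<exists>h. h ` X \<subseteq> univ M \<and> Q.pres ((\<lambda>x. (x, Inl (h x))) ` X) \<and>
    (\<forall>e e'. (\<forall>v\<in>fv \<phi>. e v \<in> X \<and> e' v = Inl (h (e v)) \<or> e v \<in> Inl ` S \<and> e' v = e v) \<longrightarrow>
       (sat N Inl e \<phi> \<longleftrightarrow> sat N Inl e' \<phi>))"
proof -
  \<comment> \<open>The exceptions secure richness for every point not paired with itself, and the
    constants of \<open>\<phi>\<close> must be paired with themselves.\<close>
  let ?F = "S \<union> exceptions (radius \<phi>) \<union> fm_consts \<phi>"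
  have wf: "well_formed L \<phi>" and cs: "fm_consts \<phi> \<subseteq> univ M"
    using \<phi> unfolding formulas_def by auto
  have F: "finite ?F" "?F \<subseteq> univ M"
    using S exceptions cs finite_fm_consts by auto
  obtain h where h: "h ` X \<subseteq> univ M"
      "Q.pres (Q.spread (radius \<phi>) ((\<lambda>x. (x, Inl (h x))) ` X \<union> Id_on (Inl ` ?F)))"
    using approximate_in_M[OF X F] by blast
  let ?P = "(\<lambda>x. (x, Inl (h x))) ` X \<union> Id_on (Inl ` ?F)"
  have PU: "?P \<subseteq> UQ \<times> UQ"
  proof (rule Un_least)
    show "(\<lambda>x. (x, Inl (h x))) ` X \<subseteq> UQ \<times> UQ"
      using X(2) h(1) by (auto simp: UQ_def)
    have "Inl ` ?F \<subseteq> UQ"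
      using F(2) unfolding UQ_def by blast
    then show "Id_on (Inl ` ?F) \<subseteq> UQ \<times> UQ"
      by auto
  qed
  have "finite ((\<lambda>z. (z, z)) ` Inl ` ?F)"
    using F(1) by blast
  then have Pfin: "finite ?P"
    using X(1) by (simp add: Id_on_def UNION_singleton_eq_range)
  have rich: "Q.rich r (Inl ` univ M) x" if "x \<in> UQ" "(x, x) \<notin> ?P" "r < radius \<phi>" for x r
    using that by (intro rich_outside_exceptions[of x "radius \<phi>"]) auto
  have "sat N Inl e \<phi> \<longleftrightarrow> sat N Inl e' \<phi>"
    if e: "\<forall>v\<in>fv \<phi>. e v \<in> X \<and> e' v = Inl (h (e v)) \<or> e v \<in> Inl ` S \<and> e' v = e v" for e e'
  proof -
    have "(e v, e' v) \<in> ?P" if "v \<in> fv \<phi>" for v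
      using bspec[OF e that] by auto
    then have "matching \<phi> ?P e e'"
      unfolding matching_def using Pfin PU h(2) rich by blast
    then show ?thesis
      using sat_matching[OF wf] by blast
  qed
  moreover have "Q.pres ((\<lambda>x. (x, Inl (h x))) ` X)"
    using Q.pres_spread_mono[OF h(2), of "(\<lambda>x. (x, Inl (h x))) ` X" 0] by simp
  ultimately show ?thesis
    using h(1) by blast
qed

text \<open>As in the Tarski-Vaught test, the only substantial case is a witness in
  \<open>N\<close>, which is moved into \<open>M\<close> while the values of the free variables stay
  fixed.\<close>

lemma sat_N_Inl:
  "\<phi> \<in> formulas L (univ M) \<Longrightarrow> range e \<subseteq> univ M \<Longrightarrow> sat M id e \<phi> \<longleftrightarrow> sat N Inl (Inl \<circ> e) \<phi>"
proof (induction \<phi> arbitrary: e)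
  case Falsum
  then show ?case by simp
next
  case (Rel r ts)
  have val: "tm_val Inl (Inl \<circ> e) t = Inl (tm_val id e t)" for t :: "'a tm"
    by (cases t) auto
  have "tm_val id e t \<in> univ M" if "t \<in> set ts" for t
  proof -
    have "tm_consts t \<subseteq> univ M"
      using that Rel.prems(1) by (auto simp: formulas_def)
    then show ?thesis
      using Rel.prems(2) by (cases t) auto
  qed
  then have "set (map (tm_val id e) ts) \<subseteq> univ M"
    by auto
  moreover have "r \<in> rels L"
    using Rel.prems(1) by (simp add: formulas_def)
  ultimately have "map Inl (map (tm_val id e) ts) \<in> rel N r \<longleftrightarrow> map (tm_val id e) ts \<in> rel M r"
    by (intro rel_N_Inl)
  moreover have "map (tm_val Inl (Inl \<circ> e)) ts = map Inl (map (tm_val id e) ts)"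
    by (simp add: val)
  ultimately show ?case
    by (metis sat.simps(2))
next
  case (Eq s t)
  have val: "tm_val Inl (Inl \<circ> e) t = Inl (tm_val id e t)" for t :: "'a tm"
    by (cases t) auto
  have "tm_val id e s = tm_val id e t \<longleftrightarrow> tm_val Inl (Inl \<circ> e) s = tm_val Inl (Inl \<circ> e) t"
    unfolding val by simp
  then show ?case by (simp only: sat.simps)
next
  case (Neg \<phi>)
  then have "\<phi> \<in> formulas L (univ M)"
    by (simp add: formulas_def)
  then show ?case
    using Neg.IH[of e] Neg.prems(2) by (simp only: sat.simps simp_thms)
next
  case (And \<phi> \<psi>)
  then have "\<phi> \<in> formulas L (univ M)" "\<psi> \<in> formulas L (univ M)"
    by (simp_all add: formulas_def)
  then show ?case
    using And.IH(1)[of e] And.IH(2)[of e] And.prems(2) by (simp only: sat.simps simp_thms)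
next
  case (Ex v \<phi>)
  have \<phi>: "\<phi> \<in> formulas L (univ M)"
    using Ex.prems(1) by (simp add: formulas_def)
  have upd: "Inl \<circ> e(v := x) = (Inl \<circ> e)(v := Inl x)" for x
    by auto
  have IH: "sat M id (e(v := x)) \<phi> \<longleftrightarrow> sat N Inl ((Inl \<circ> e)(v := Inl x)) \<phi>" if "x \<in> univ M" for x
  proof -
    have "range (e(v := x)) \<subseteq> univ M"
      using Ex.prems(2) that by auto
    from Ex.IH[OF \<phi> this] show ?thesis
      unfolding upd .
  qed
  show ?case
  proof
    assume "sat M id e (Ex v \<phi>)"
    then obtain x where x: "x \<in> univ M" "sat M id (e(v := x)) \<phi>"
      by auto
    then have "sat N Inl ((Inl \<circ> e)(v := Inl x)) \<phi>"
      using IH[OF x(1)] by (simp only:)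
    moreover have "Inl x \<in> univ N"
      using x(1) by (simp add: UQ_def)
    ultimately show "sat N Inl (Inl \<circ> e) (Ex v \<phi>)"
      unfolding sat.simps by (intro bexI)
  next
    assume "sat N Inl (Inl \<circ> e) (Ex v \<phi>)"
    then obtain x where x: "x \<in> UQ" "sat N Inl ((Inl \<circ> e)(v := x)) \<phi>"
      by auto
    have S: "finite (e ` fv \<phi>)" "e ` fv \<phi> \<subseteq> univ M"
      using finite_fv Ex.prems(2) by auto
    have X: "finite {x}" "{x} \<subseteq> UQ"
      using x(1) by auto
    obtain h where h: "h ` {x} \<subseteq> univ M"
      "\<forall>d d'. (\<forall>v\<in>fv \<phi>. d v \<in> {x} \<and> d' v = Inl (h (d v)) \<or> d v \<in> Inl ` e ` fv \<phi> \<and> d' v = d v) \<longrightarrow>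
         (sat N Inl d \<phi> \<longleftrightarrow> sat N Inl d' \<phi>)"
      using approximate_sat[OF \<phi> X S] by blast
    have "sat N Inl ((Inl \<circ> e)(v := x)) \<phi> \<longleftrightarrow> sat N Inl ((Inl \<circ> e)(v := Inl (h x))) \<phi>"
      by (rule h(2)[rule_format]) auto
    moreover have hx: "h x \<in> univ M"
      using h(1) by simp
    ultimately have "sat M id (e(v := h x)) \<phi>"
      using IH[OF hx] x(2) by (simp only:)
    then show "sat M id e (Ex v \<phi>)"
      unfolding sat.simps using hx by (intro bexI)
  qed
qed

lemma elementary_extension_N: "elementary_extension L M Inl N"
  unfolding elementary_extension_def
proof (intro conjI ballI allI impI)
  show "is_struct L N" by (rule struct_N)
  show "inj_on Inl (univ M)" by simp
  show "Inl ` univ M \<subseteq> univ N" by (simp add: UQ_def)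
qed (rule sat_N_Inl)

text \<open>A tuple of the extension is replaced by one of \<open>M\<close> that agrees with it both
  on \<open>\<phi>\<close> and on \<open>RQ i\<close>; in \<open>M\<close> the two coincide by
  assumption.\<close>

lemma defined_rel_N:
  assumes \<phi>: "\<phi> \<in> formulas L (univ M)" and i: "i \<in> I" and R: "R i = defined_rel M id \<phi>"
    and ar: "ar i = card (fv \<phi>)"
  shows "defined_rel N Inl \<phi> = RQ i"
proof -
  let ?xs = "sorted_list_of_set (fv \<phi>)"
  obtain u where u: "u \<in> univ M"
    using struct unfolding is_struct_def by blast
  have key: "sat N Inl e \<phi> \<longleftrightarrow> map e ?xs \<in> RQ i" if e: "range e \<subseteq> UQ" for e
  proof -
    have X: "finite (e ` fv \<phi>)" "e ` fv \<phi> \<subseteq> UQ"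
      using finite_fv e by auto
    obtain h where h: "h ` e ` fv \<phi> \<subseteq> univ M" "Q.pres ((\<lambda>x. (x, Inl (h x))) ` e ` fv \<phi>)"
      "\<forall>d d'. (\<forall>v\<in>fv \<phi>. d v \<in> e ` fv \<phi> \<and> d' v = Inl (h (d v)) \<or> d v \<in> Inl ` {} \<and> d' v = d v) \<longrightarrow>
         (sat N Inl d \<phi> \<longleftrightarrow> sat N Inl d' \<phi>)"
      using approximate_sat[OF \<phi> X finite.emptyI empty_subsetI] by (elim exE conjE)
    define e' where "e' v = (if v \<in> fv \<phi> then h (e v) else u)" for v
    have e': "range e' \<subseteq> univ M"
      using h(1) u by (auto simp: e'_def)
    have "sat N Inl e \<phi> \<longleftrightarrow> sat N Inl (Inl \<circ> e') \<phi>"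
      by (rule h(3)[rule_format]) (simp add: e'_def)
    also have "\<dots> \<longleftrightarrow> sat M id e' \<phi>"
      using sat_N_Inl[OF \<phi> e'] by simp
    also have "\<dots> \<longleftrightarrow> map e' ?xs \<in> R i"
      unfolding R map_in_defined_rel[OF e'] ..
    also have "\<dots> \<longleftrightarrow> map Inl (map e' ?xs) \<in> RQ i"
      by (simp only: map_Inl_RQ)
    also have "\<dots> \<longleftrightarrow> map e ?xs \<in> RQ i"
    proof (rule sym, rule Q.presD[OF h(2) i])
      show "list_all2 (\<lambda>a b. (a, b) \<in> (\<lambda>x. (x, Inl (h x))) ` e ` fv \<phi>) (map e ?xs) (map Inl (map e' ?xs))"
        by (auto simp: list.rel_map list_all2_same e'_def finite_fv)
    qed
    finally show ?thesis .
  qed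
  show ?thesis
  proof (intro set_eqI iffI)
    fix t assume "t \<in> defined_rel N Inl \<phi>"
    then show "t \<in> RQ i"
      unfolding defined_rel_def using key by auto
  next
    fix t assume t: "t \<in> RQ i"
    then have "length t = ar i" "set t \<subseteq> UQ"
      using Q.R_tuple[OF i] by auto
    moreover have "length ?xs = ar i"
      using ar by simp
    ultimately obtain e where e: "map e ?xs = t" "range e \<subseteq> insert (Inl u) (set t)"
      using ex_valuation[of ?xs t "Inl u"] by auto
    then have rng: "range e \<subseteq> UQ"
      using \<open>set t \<subseteq> UQ\<close> u by (auto simp: UQ_def)
    then have "map e ?xs \<in> defined_rel N Inl \<phi>"
      using key t e map_in_defined_rel[of e N \<phi> Inl] by simp
    then show "t \<in> defined_rel N Inl \<phi>"
      using e by simp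
  qed
qed

text \<open>No tuple joins a copy to \<open>M\<close>, so the identity on \<open>M\<close> and the
  change of copy number glue to a map preserving \<open>RQ\<close>, on which the
  \<open>L\<close>-relations depend.\<close>

lemma isomorphic_over_copies: "isomorphic_over L N (Inl ` univ M) (copy j) (copy k)"
proof -
  obtain f where copy: "(\<forall>x. f (Inl x) = Inl x) \<and> bij_betw f (copy j) (copy k) \<and>
      Q.pres ((\<lambda>z. (z, f z)) ` copy j)"
    using copy_transfer[where j = j and k = k] by (rule exE)
  note f = copy[THEN conjunct1] copy[THEN conjunct2, THEN conjunct1] copy[THEN conjunct2, THEN conjunct2]
  let ?B = "Inl ` univ M"
  let ?S = "?B \<union> copy j" and ?T = "?B \<union> copy k"
  have sub: "?S \<subseteq> UQ" "?T \<subseteq> UQ"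
    unfolding UQ_copies by blast+
  have img: "f ` ?S = ?T"
    using f(1,2) unfolding bij_betw_def by (simp add: image_Un image_image)
  have inj: "inj_on f ?S"
    unfolding inj_on_Un
  proof (intro conjI)
    show "inj_on f ?B" "inj_on f (copy j)"
      using f(1,2) by (auto simp: inj_on_def bij_betw_def)
    have "f ` ?B = ?B" "f ` copy j = copy k"
      using f(1,2) by (simp_all add: image_image bij_betw_def)
    then have "f ` (?B - copy j) \<subseteq> ?B" "f ` (copy j - ?B) \<subseteq> copy k"
      using image_mono[OF Diff_subset, of f ?B "copy j"] image_mono[OF Diff_subset, of f "copy j" ?B]
      by simp_all
    then show "f ` (?B - copy j) \<inter> f ` (copy j - ?B) = {}"
      using copy_Inl[of k "univ M"] by (meson disjoint_iff subsetD)
  qed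
  have comp_Inl: "Q.comp (Inl a) \<subseteq> ?B" if "a \<in> univ M" for a
    unfolding Q.comp_def using walk_Inl walk_in_U[OF that] by auto
  have pres: "Q.pres ((\<lambda>z. (z, f z)) ` ?S)"
  proof (rule NP.glue_comps)
    show "?S \<subseteq> univ N" "inj_on f ?S" "f ` ?S \<subseteq> univ N"
      using sub inj img by auto
    fix x assume "x \<in> ?S"
    then consider a where "a \<in> univ M" "x = Inl a" | w where "w \<in> W" "x = emb j w"
      unfolding copy_def by blast
    then have "Q.comp x \<subseteq> ?S \<and> Q.pres ((\<lambda>z. (z, f z)) ` Q.comp x) \<and> f ` Q.comp x = Q.comp (f x)"
    proof cases
      case 1
      then have fixed: "f z = z" if "z \<in> Q.comp x" for z
        using comp_Inl[OF 1(1)] f(1) that by auto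
      then have "Q.pres ((\<lambda>z. (z, f z)) ` Q.comp x)"
        by (intro Q.pres_Id) auto
      moreover have "f ` Q.comp x = Q.comp (f x)"
        using fixed Q.comp_self[of x] by simp
      ultimately show ?thesis
        using comp_Inl 1 by blast
    next
      case 2
      then have "f x \<in> copy k"
        using f(2) unfolding bij_betw_def copy_def by blast
      then obtain v where "v \<in> W" "f x = emb k v"
        unfolding copy_def by (rule imageE)
      then have "Q.comp (f x) = copy k"
        using comp_emb by simp
      then show ?thesis
        using 2 comp_emb f(2,3) unfolding bij_betw_def by auto
    qed
    then show "Q.comp x \<subseteq> ?S" "Q.pres ((\<lambda>z. (z, f z)) ` Q.comp x)" "f ` Q.comp x = Q.comp (f x)"
      by blast+
  qed
  have UQ_Int: "UQ \<inter> ?S = ?S" "UQ \<inter> ?T = ?T"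
    using sub by (simp_all only: Int_absorb1)
  have "isomorphism L f (induced N ?S) (induced N ?T)"
    unfolding isomorphism_def induced_def struct.simps univ_N UQ_Int
  proof (intro conjI ballI allI impI)
    show "bij_betw f ?S ?T"
      using inj img unfolding bij_betw_def by (rule conjI)
    fix r t assume r: "r \<in> rels L" and len: "length t = arity L r \<and> set t \<subseteq> ?S"
    have t: "set t \<subseteq> ?S"
      using len by (rule conjunct2)
    have "t \<in> rel N r \<longleftrightarrow> map f t \<in> rel N r"
    proof (rule NP.rel_map_iff[OF pres _ _ r t])
      show "?S \<subseteq> univ N" "f ` ?S \<subseteq> univ N"
        unfolding img univ_N by (rule sub)+
    qed
    moreover have "set (map f t) \<subseteq> ?T"
      using image_mono[OF t, of f] unfolding img by simp
    ultimately show "t \<in> {t \<in> rel N r. set t \<subseteq> ?S} \<longleftrightarrow> map f t \<in> {t \<in> rel N r. set t \<subseteq> ?T}"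
      using t by (simp only: mem_Collect_eq)
  qed
  moreover have "\<forall>b\<in>?B. f b = b"
    using f(1) by auto
  ultimately show ?thesis
    unfolding isomorphic_over_def using f(2) by (intro exI[of _ f] conjI)
qed

end

section \<open>The structure of a basis\<close>

lemma (in labelled_structure) trancl_mates_Image:
  assumes x: "x \<in> U"
  shows "{(a, b). \<exists>i\<in>I. \<exists>t\<in>R i. a \<in> set t \<and> b \<in> set t}\<^sup>+ `` {x} = comp x" (is "?G\<^sup>+ `` {x} = _")
proof
  have sub: "y \<in> comp x" if "(x, y) \<in> ?G\<^sup>+" for y
    using that
  proof (induction rule: trancl_induct)
    case (base y)
    then obtain i t where "i \<in> I" "t \<in> R i" "x \<in> set t" "y \<in> set t" by blast
    then show ?case using tuple_in_comp by blast
  next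
    case (step y z)
    then obtain i t where "i \<in> I" "t \<in> R i" "y \<in> set t" "z \<in> set t" by blast
    then show ?case using tuple_in_comp[of i t y] comp_trans[OF step.IH] by blast
  qed
  then show "?G\<^sup>+ `` {x} \<subseteq> comp x" by blast
  show "comp x \<subseteq> ?G\<^sup>+ `` {x}"
  proof (rule closed_imp_comp_subset)
    \<comment> \<open>A transitive closure without reflexivity contains \<open>x\<close> only
      because \<open>eq\<close> makes \<open>x\<close> its own mate.\<close>
    have "[x, x] \<in> R eq"
      using x by (simp add: pair_in_eq)
    then have "(x, x) \<in> ?G"
      using eq_in by force
    then show "x \<in> ?G\<^sup>+ `` {x}" by blast
    fix y k assume y: "y \<in> ?G\<^sup>+ `` {x}" and k: "k < D"
    then have "y \<in> U"
      using sub comp_subset_U[OF x] by blast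
    then have "(y, nbr k y) \<in> ?G"
      using nbr_mate[OF _ k] by blast
    then show "nbr k y \<in> ?G\<^sup>+ `` {x}"
      using y by (auto intro: trancl_into_trancl)
  qed
qed

text \<open>The symbol for equality is itself a formula, so that the relations can be indexed by
  \<open>insert eq_fm A\<close>, whether or not \<open>A\<close> lists it.\<close>

abbreviation eq_fm :: "('r, 'c) fm" where
  "eq_fm \<equiv> Eq (Var 0) (Var (Suc 0))"

lemma sorted_fv_eq_fm: "sorted_list_of_set (fv (eq_fm :: ('r, 'c) fm)) = [0, Suc 0]"
proof -
  have "fv (eq_fm :: ('r, 'c) fm) = {0, Suc 0}" by auto
  then show ?thesis
    by (simp add: sorted_list_of_set_insert_remove)
qed

lemma defined_rel_eq_fm: "defined_rel M \<kappa> eq_fm = {[x, x] | x. x \<in> univ M}"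
proof (intro set_eqI iffI)
  fix t assume "t \<in> defined_rel M \<kappa> eq_fm"
  then obtain e where "t = [e 0, e (Suc 0)]" "range e \<subseteq> univ M" "e 0 = e (Suc 0)"
    unfolding defined_rel_def sorted_fv_eq_fm by auto
  then show "t \<in> {[x, x] | x. x \<in> univ M}" by auto
next
  fix t assume "t \<in> {[x, x] | x. x \<in> univ M}"
  then obtain x where x: "t = [x, x]" "x \<in> univ M" by blast
  then have "range (\<lambda>_ :: nat. x) \<subseteq> univ M" by auto
  from map_in_defined_rel[OF this, of eq_fm \<kappa>] show "t \<in> defined_rel M \<kappa> eq_fm"
    unfolding sorted_fv_eq_fm using x(1) by simp
qed

lemma defined_rel_tuple: "t \<in> defined_rel M \<kappa> \<phi> \<Longrightarrow> length t = card (fv \<phi>) \<and> set t \<subseteq> univ M"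
  unfolding defined_rel_def using finite_fv[of \<phi>] by (auto dest: range_subsetD)

text \<open>An atomic formula may repeat variables or contain constants. The tuples it defines then
  only list entries of tuples of the relation itself, so it adds no mates.\<close>

lemma mates_basis:
  fixes A :: "('r, 'a) fm set" and N :: "('r, 'b) struct"
  shows "mates (basis_lang A) (basis_consts A) (basis_struct N \<iota> A) \<iota> =
    {(a, b). \<exists>\<phi>\<in>insert eq_fm A. \<exists>t\<in>defined_rel N \<iota> \<phi>. a \<in> set t \<and> b \<in> set t}"
    (is "?L = ?R")
proof (intro equalityI subsetI)
  fix q assume "q \<in> ?L"
  then obtain a b \<alpha> t where q: "q = (a, b)" and \<alpha>: "\<alpha> \<in> atomic_formulas (basis_lang A) (basis_consts A)"
      and t: "t \<in> defined_rel (basis_struct N \<iota> A) \<iota> \<alpha>" "a \<in> set t" "b \<in> set t"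
    unfolding mates_def by blast
  obtain e where e: "t = map e (sorted_list_of_set (fv \<alpha>))" "range e \<subseteq> univ N"
      "sat (basis_struct N \<iota> A) \<iota> e \<alpha>"
    using t(1) unfolding defined_rel_def basis_struct_def by auto
  obtain v w where vw: "v \<in> fv \<alpha>" "a = e v" "w \<in> fv \<alpha>" "b = e w"
    using t(2,3) e(1) finite_fv[of \<alpha>] by auto
  consider r ts where "\<alpha> = Rel r ts" | s u where "\<alpha> = Eq s u"
    using \<alpha> unfolding atomic_formulas_def by blast
  then show "q \<in> ?R"
  proof cases
    case 1
    have "r \<in> A"
      using \<alpha> 1 unfolding atomic_formulas_def formulas_def basis_lang_def by simp
    moreover have "map (tm_val \<iota> e) ts \<in> defined_rel N \<iota> r"
      using e(3) 1 \<open>r \<in> A\<close> unfolding basis_struct_def by simp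
    moreover have "e x \<in> set (map (tm_val \<iota> e) ts)" if "x \<in> fv \<alpha>" for x
    proof -
      obtain \<tau> where \<tau>: "\<tau> \<in> set ts" "x \<in> tm_vars \<tau>"
        using \<open>x \<in> fv \<alpha>\<close> 1 by auto
      have "tm_val \<iota> e \<tau> = e x"
        using \<tau>(2) by (cases \<tau>) simp_all
      then show ?thesis
        using \<tau>(1) by (metis image_eqI set_map)
    qed
    ultimately show ?thesis
      unfolding q vw(2,4) using vw(1,3) by blast
  next
    case 2
    \<comment> \<open>All variables of an equation take the same value, so it only makes an element
      its own mate.\<close>
    have "e v = e w"
      using e(3) vw 2 by (cases s; cases u) auto
    moreover have "[e v, e v] \<in> defined_rel N \<iota> eq_fm"
      using e(2) unfolding defined_rel_eq_fm by blast
    ultimately show ?thesis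
      unfolding q vw(2,4) by (auto intro!: bexI[of _ eq_fm] bexI[of _ "[e w, e w]"])
  qed
next
  fix q assume "q \<in> ?R"
  then obtain a b \<phi> t where q: "q = (a, b)" and \<phi>: "\<phi> \<in> insert eq_fm A"
      and t: "t \<in> defined_rel N \<iota> \<phi>" "a \<in> set t" "b \<in> set t"
    by blast
  have "\<exists>\<alpha>\<in>atomic_formulas (basis_lang A) (basis_consts A). t \<in> defined_rel (basis_struct N \<iota> A) \<iota> \<alpha>"
  proof (cases "\<phi> \<in> A")
    case True
    let ?n = "card (fv \<phi>)"
    let ?\<alpha> = "Rel \<phi> (map Var [0..<?n]) :: (('r, 'a) fm, 'a) fm"
    have len: "length t = ?n" and sub: "set t \<subseteq> univ N"
      using defined_rel_tuple[OF t(1)] by auto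
    obtain e where e: "map e [0..<?n] = t" "range e \<subseteq> insert a (set t)"
      using ex_valuation[of "[0..<?n]" t a] len by auto
    have rng: "range e \<subseteq> univ (basis_struct N \<iota> A)"
      using e(2) t(2) sub unfolding basis_struct_def by auto
    have fv: "sorted_list_of_set (fv ?\<alpha>) = [0..<?n]"
    proof -
      have "fv ?\<alpha> = {0..<?n}" by auto
      then show ?thesis
        by (simp only: sorted_list_of_set_range)
    qed
    have "map (tm_val \<iota> e) (map Var [0..<?n]) = t"
      unfolding e(1)[symmetric] by simp
    then have "sat (basis_struct N \<iota> A) \<iota> e ?\<alpha>"
      using t(1) True by (simp add: basis_struct_def)
    then have "t \<in> defined_rel (basis_struct N \<iota> A) \<iota> ?\<alpha>"
      using map_in_defined_rel[OF rng, of ?\<alpha> \<iota>] unfolding fv e(1) by blast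
    moreover have "?\<alpha> \<in> atomic_formulas (basis_lang A) (basis_consts A)"
      using True by (auto simp: atomic_formulas_def formulas_def basis_lang_def)
    ultimately show ?thesis by blast
  next
    case False
    then have "\<phi> = eq_fm"
      using \<phi> by simp
    from t(1) have "t \<in> {[x, x] | x. x \<in> univ N}"
      unfolding \<open>\<phi> = eq_fm\<close> defined_rel_eq_fm .
    then have "t \<in> defined_rel (basis_struct N \<iota> A) \<iota> eq_fm"
      unfolding defined_rel_eq_fm basis_struct_def by simp
    moreover have "eq_fm \<in> atomic_formulas (basis_lang A) (basis_consts A)"
      by (auto simp: atomic_formulas_def formulas_def)
    ultimately show ?thesis by blast
  qed
  then show "q \<in> ?L"
    unfolding q mates_def using t(2,3) by blast
qed

lemma sat_rename_vars: "qfree \<phi> \<Longrightarrow> sat M \<kappa> e (rename_vars f \<phi>) \<longleftrightarrow> sat M \<kappa> (e \<circ> f) \<phi>"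
proof (induction \<phi>)
  have val: "tm_val \<kappa> e (rename_tm f t) = tm_val \<kappa> (e \<circ> f) t" for t
    by (cases t) auto
  {
    case (Rel r ts)
    have "map (tm_val \<kappa> e) (map (rename_tm f) ts) = map (tm_val \<kappa> (e \<circ> f)) ts"
      by (simp add: val)
    then show ?case by (simp only: sat.simps rename_vars.simps)
  next
    case (Eq s t)
    show ?case by (simp only: sat.simps rename_vars.simps val)
  }
qed auto

lemma ex_surj_lessThan:
  assumes "finite S" "S \<noteq> {}" "card S \<le> D"
  shows "\<exists>f :: nat \<Rightarrow> 'a. f ` {..<D} = S"
proof -
  obtain h where h: "bij_betw h {0..<card S} S"
    using ex_bij_betw_nat_finite[OF assms(1)] by blast
  obtain z where z: "z \<in> S" using assms(2) by blast
  let ?f = "\<lambda>i. if i < card S then h i else z"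
  have "?f ` {..<D} = S"
  proof
    show "?f ` {..<D} \<subseteq> S"
      using z bij_betwE[OF h] by auto
    show "S \<subseteq> ?f ` {..<D}"
    proof
      fix x assume "x \<in> S"
      then obtain i where "i < card S" "x = h i"
        using bij_betw_imp_surj_on[OF h] by force
      then show "x \<in> ?f ` {..<D}"
        using assms(3) by (intro image_eqI[of _ _ i]) auto
    qed
  qed
  then show ?thesis by blast
qed

text \<open>Mutual algebraicity bounds the degree, which gives \<open>nbr\<close>;
  \<open>rel_pres\<close> follows by evaluating a boolean combination for each atomic formula at two
  tuples of the same type.\<close>

lemma MA_basis_labelled:
  assumes M: "is_struct L M" and A: "MA_basis L M A"
  shows "\<exists>D nbr. presented_structure M (insert eq_fm A) (\<lambda>\<phi>. card (fv \<phi>)) (defined_rel M id) eq_fm D nbr L"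
proof -
  let ?I = "insert eq_fm A" and ?R = "defined_rel M id"
  have fin: "finite ?I"
    using A unfolding MA_basis_def by simp
  have "\<exists>K. \<forall>m\<in>univ M. finite {t \<in> ?R \<phi>. m \<in> set t} \<and> card {t \<in> ?R \<phi>. m \<in> set t} \<le> K"
    if \<phi>: "\<phi> \<in> ?I" for \<phi>
  proof (cases "\<phi> \<in> A")
    case True
    then show ?thesis
      using A unfolding MA_basis_def mutually_algebraic_formula_def mutually_algebraic_rel_def by blast
  next
    case False
    then have "\<phi> = eq_fm"
      using \<phi> by simp
    then have sub: "{t \<in> ?R \<phi>. m \<in> set t} \<subseteq> {[m, m]}" for m
      by (auto simp: defined_rel_eq_fm)
    have "finite {t \<in> ?R \<phi>. m \<in> set t}" "card {t \<in> ?R \<phi>. m \<in> set t} \<le> 1" for m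
      using finite_subset[OF sub[of m]] card_mono[OF _ sub[of m]] by simp_all
    then show ?thesis by blast
  qed
  then have "\<forall>\<phi>\<in>?I. \<exists>K. \<forall>m\<in>univ M. finite {t \<in> ?R \<phi>. m \<in> set t} \<and> card {t \<in> ?R \<phi>. m \<in> set t} \<le> K"
    by (rule ballI)
  then obtain K where "\<forall>\<phi>\<in>?I. \<forall>m\<in>univ M.
      finite {t \<in> ?R \<phi>. m \<in> set t} \<and> card {t \<in> ?R \<phi>. m \<in> set t} \<le> K \<phi>"
    by (rule bchoice[THEN exE])
  then have K: "finite {t \<in> ?R \<phi>. m \<in> set t} \<and> card {t \<in> ?R \<phi>. m \<in> set t} \<le> K \<phi>"
    if "\<phi> \<in> ?I" "m \<in> univ M" for \<phi> m
    using that by blast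
  define nb where "nb x = (\<Union>\<phi>\<in>?I. \<Union>t\<in>{t \<in> ?R \<phi>. x \<in> set t}. set t)" for x
  \<comment> \<open>At most \<open>K \<phi>\<close> tuples of each relation pass through a point,
    and each has at most \<open>card (fv \<phi>)\<close> distinct entries.\<close>
  define D where "D = (\<Sum>\<phi>\<in>?I. K \<phi> * card (fv \<phi>))"
  have nb_self: "x \<in> nb x" if "x \<in> univ M" for x
  proof -
    have "[x, x] \<in> ?R eq_fm"
      using that unfolding defined_rel_eq_fm by blast
    then show ?thesis
      unfolding nb_def by force
  qed
  have "finite (nb x) \<and> card (nb x) \<le> D" if x: "x \<in> univ M" for x
  proof
    show "finite (nb x)"
      unfolding nb_def using fin K x by blast
    have "card (nb x) \<le> (\<Sum>\<phi>\<in>?I. card (\<Union>t\<in>{t \<in> ?R \<phi>. x \<in> set t}. set t))"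
      unfolding nb_def by (rule card_UN_le[OF fin])
    also have "\<dots> \<le> D"
      unfolding D_def
    proof (rule sum_mono)
      fix \<phi> assume \<phi>: "\<phi> \<in> ?I"
      let ?T = "{t \<in> ?R \<phi>. x \<in> set t}"
      have "card (\<Union>t\<in>?T. set t) \<le> (\<Sum>t\<in>?T. card (set t))"
        using K[OF \<phi> x] by (intro card_UN_le) simp
      also have "\<dots> \<le> of_nat (card ?T) * card (fv \<phi>)"
      proof (rule sum_bounded_above)
        fix t assume "t \<in> ?T"
        then show "card (set t) \<le> card (fv \<phi>)"
          using defined_rel_tuple[of t M id \<phi>] card_length[of t] by simp
      qed
      also have "\<dots> \<le> K \<phi> * card (fv \<phi>)"
        using K[OF \<phi> x] by simp
      finally show "card (\<Union>t\<in>?T. set t) \<le> K \<phi> * card (fv \<phi>)" .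
    qed
    finally show "card (nb x) \<le> D" .
  qed
  then have "\<forall>x\<in>univ M. \<exists>f :: nat \<Rightarrow> 'b. f ` {..<D} = nb x"
    using nb_self ex_surj_lessThan by (metis empty_iff)
  then obtain f where f: "\<And>x. x \<in> univ M \<Longrightarrow> f x ` {..<D} = nb x"
    by metis
  define nbr where "nbr k x = f x k" for k :: nat and x
  interpret labelled_structure "univ M" ?I "\<lambda>\<phi>. card (fv \<phi>)" ?R eq_fm D nbr
  proof
    show "finite ?I" by (rule fin)
    show "length t = card (fv \<phi>) \<and> set t \<subseteq> univ M" if "t \<in> ?R \<phi>" for \<phi> t
      using defined_rel_tuple that by blast
    show "eq_fm \<in> ?I" by simp
    show "?R eq_fm = {[x, x] | x. x \<in> univ M}" by (rule defined_rel_eq_fm)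
    show "\<exists>k<D. nbr k x = y" if t: "\<phi> \<in> ?I" "t \<in> ?R \<phi>" "x \<in> set t" "y \<in> set t" for \<phi> t x y
    proof -
      have "y \<in> nb x"
        unfolding nb_def using t by blast
      moreover have "x \<in> univ M"
        using defined_rel_tuple t by blast
      ultimately have "y \<in> f x ` {..<D}"
        using f by simp
      then show ?thesis
        unfolding nbr_def by auto
    qed
    show "\<exists>\<phi>\<in>?I. \<exists>t\<in>?R \<phi>. x \<in> set t \<and> nbr k x \<in> set t" if "x \<in> univ M" "k < D" for x k
    proof -
      have "nbr k x \<in> nb x"
        unfolding nbr_def f[OF that(1), symmetric] using that(2) by blast
      then show ?thesis
        unfolding nb_def by blast
    qed
  qed
  have "presented_structure M ?I (\<lambda>\<phi>. card (fv \<phi>)) ?R eq_fm D nbr L"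
  proof
    show "is_struct L M" by (rule M)
    fix r s t
    assume r: "r \<in> rels L" and len: "length s = length t" and s: "set s \<subseteq> univ M"
      and t: "set t \<subseteq> univ M" and P: "pres (set (zip s t))" and sr: "s \<in> rel M r"
    show "t \<in> rel M r"
    proof (cases "s = []")
      case True
      then show ?thesis using len sr by simp
    next
      case False
      let ?n = "length s"
      define \<alpha> :: "('a, 'b) fm" where "\<alpha> = Rel r (map Var [0..<?n])"
      have "length s = arity L r"
        using M r sr unfolding is_struct_def by blast
      then have "\<alpha> \<in> atomic_formulas L {}"
        using r unfolding \<alpha>_def atomic_formulas_def formulas_def by auto
      then obtain \<psi> where \<psi>: "\<psi> \<in> bool_combs ({rename_vars f \<phi> | f \<phi>. \<phi> \<in> A} \<union> {Eq (Var i) (Var j) | i j. True})"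
          "equivalent_in M id \<alpha> \<psi>"
        using A unfolding MA_basis_def by blast
      \<comment> \<open>\<open>\<psi>\<close> may contain variables absent from
        \<open>\<alpha>\<close>. Sending them to the first entry keeps \<open>e s\<close> and
        \<open>e t\<close> paired at every variable; this default is why empty tuples are treated
        apart.\<close>
      define e where "e = (\<lambda>xs :: 'b list. \<lambda>v. if v < ?n then xs ! v else xs ! 0)"
      have e_in: "e xs v \<in> set xs" if "length xs = ?n" for xs v
        unfolding e_def using that False by auto
      have e_pair: "(e s v, e t v) \<in> set (zip s t)" for v
        unfolding e_def using len False by (auto simp: set_zip)
      have \<alpha>_sat: "sat M id (e xs) \<alpha> \<longleftrightarrow> xs \<in> rel M r" if "length xs = ?n" for xs
      proof -
        have "map (tm_val id (e xs)) (map Var [0..<?n]) = xs"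
          using that by (intro nth_equalityI) (simp_all add: e_def)
        then show ?thesis
          unfolding \<alpha>_def by simp
      qed
      have rng: "range (e s) \<subseteq> univ M" "range (e t) \<subseteq> univ M"
        using e_in[of s] e_in[of t] s t len by auto
      have "sat M id (e s) \<psi> \<longleftrightarrow> sat M id (e t) \<psi>"
        using \<psi>(1)
      proof (induction rule: bool_combs.induct)
        case (1 \<phi>)
        then consider f \<theta> where "\<theta> \<in> A" "\<phi> = rename_vars f \<theta>" | i j where "\<phi> = Eq (Var i) (Var j)"
          by blast
        then show ?case
        proof cases
          case 1
          then have \<theta>: "qfree \<theta>"
            using A unfolding MA_basis_def by blast
          let ?xs = "sorted_list_of_set (fv \<theta>)"
          have rngs: "range (e xs \<circ> f) \<subseteq> univ M" if "xs = s \<or> xs = t" for xs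
            using rng that by auto
          have "list_all2 (\<lambda>a b. (a, b) \<in> set (zip s t)) (map (e s \<circ> f) ?xs) (map (e t \<circ> f) ?xs)"
            using e_pair by (simp add: list.rel_map list_all2_same)
          then have "map (e s \<circ> f) ?xs \<in> ?R \<theta> \<longleftrightarrow> map (e t \<circ> f) ?xs \<in> ?R \<theta>"
            using presD[OF P] 1(1) by blast
          then have "sat M id (e s \<circ> f) \<theta> \<longleftrightarrow> sat M id (e t \<circ> f) \<theta>"
            using map_in_defined_rel[OF rngs[of s], of \<theta> id] map_in_defined_rel[OF rngs[of t], of \<theta> id]
            by simp
          then show ?thesis
            unfolding 1(2) sat_rename_vars[OF \<theta>] .
        next
          case 2
          have "list_all2 (\<lambda>a b. (a, b) \<in> set (zip s t)) [e s i, e s j] [e t i, e t j]"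
            using e_pair by simp
          then have "[e s i, e s j] \<in> ?R eq_fm \<longleftrightarrow> [e t i, e t j] \<in> ?R eq_fm"
            by (rule presD[OF P eq_in])
          then show ?thesis
            using rng unfolding pair_in_eq 2 by auto
        qed
      qed simp_all
      then have "sat M id (e s) \<alpha> \<longleftrightarrow> sat M id (e t) \<alpha>"
        using \<psi>(2) rng unfolding equivalent_in_def by blast
      then show ?thesis
        using \<alpha>_sat[of s] \<alpha>_sat[of t] len sr by simp
    qed
  qed
  then show ?thesis by blast
qed

theorem theorem8:
  fixes L :: "'r lang"
    and M :: "('r, 'a) struct"
    and A :: "('r, 'a) fm set"
  assumes "finite (rels L)"
    and "is_struct L M"
    and "countable (univ M)"
    and "mutually_algebraic L M"
    and "\<not> cellular L M"
    and "MA_basis L M A"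
  shows "\<exists>N :: ('r, 'a + nat) struct.
           elementary_extension L M Inl N \<and>
           (\<exists>\<C>. infinite \<C> \<and>
                \<C> \<subseteq> components_over N Inl A \<and>
                (\<forall>C\<in>\<C>. infinite C \<and> C \<inter> Inl ` univ M = {}) \<and>
                (\<forall>C\<in>\<C>. \<forall>C'\<in>\<C>. isomorphic_over L N (Inl ` univ M) C C') \<and>
                univ N = Inl ` univ M \<union> \<Union>\<C>)"
proof -
  let ?I = "insert eq_fm A"
  obtain D nbr where pres: "presented_structure M ?I (\<lambda>\<phi>. card (fv \<phi>)) (defined_rel M id) eq_fm D nbr L"
    using MA_basis_labelled[OF assms(2,6)] by blast
  interpret presented_structure M ?I "\<lambda>\<phi>. card (fv \<phi>)" "defined_rel M id" eq_fm D nbr L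
    by (rule pres)
  have "\<exists>x\<in>univ M. \<not> (finite (comp x) \<and> card (comp x) \<le> b)" for b
    using bounded_comps_imp_cellular[OF assms(3), of b] assms(5) by blast
  then obtain p where p: "inj p" "\<And>n. p n \<in> univ M"
    "\<And>n. finite (comp (p n)) \<Longrightarrow> n \<le> card (comp (p n))"
    "\<And>r. \<exists>\<tau>. \<forall>\<^sub>F n in sequentially. profile r (p n) = \<tau>"
    using convergent_sequence by blast
  interpret elementary_limit M ?I "\<lambda>\<phi>. card (fv \<phi>)" "defined_rel M id" eq_fm D nbr L p
    by (intro elementary_limit.intro limit_component.intro limit_component_axioms.intro
        pres labelled_structure_axioms p)
  have "defined_rel N Inl \<phi> = RQ \<phi>" if \<phi>: "\<phi> \<in> ?I" for \<phi>
  proof (rule defined_rel_N)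
    show "\<phi> \<in> formulas L (univ M)"
      using \<phi> assms(6) unfolding MA_basis_def by (auto simp: formulas_def)
  qed (use \<phi> in simp_all)
  then have "mates (basis_lang A) (basis_consts A) (basis_struct N Inl A) Inl =
      {(a, b). \<exists>\<phi>\<in>?I. \<exists>t\<in>RQ \<phi>. a \<in> set t \<and> b \<in> set t}"
    unfolding mates_basis by auto
  then have comps: "components_over N Inl A = UQ // {(a, b). \<exists>\<phi>\<in>?I. \<exists>t\<in>RQ \<phi>. a \<in> set t \<and> b \<in> set t}\<^sup>+"
    unfolding components_over_def MA_components_def by (simp add: basis_struct_def[of N] univ_N)
  have "copy j \<in> components_over N Inl A" for j
    \<comment> \<open>The empty word names a point of each copy, whose class under mates is the
      whole copy.\<close>
    unfolding comps comp_emb[OF lists.Nil, of j, symmetric] Q.trancl_mates_Image[OF emb_in_UQ, symmetric]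
    by (rule quotientI[OF emb_in_UQ])
  moreover have "infinite (range copy)"
  proof (rule range_inj_infinite)
    show "inj copy"
    proof (rule injI, rule ccontr)
      fix j k assume "copy j = copy k" "j \<noteq> k"
      then have "copy j = {}"
        using copy_disjoint[of j k] by simp
      then show False
        using infinite_copy[of j] by simp
    qed
  qed
  ultimately have "infinite (range copy) \<and> range copy \<subseteq> components_over N Inl A \<and>
      (\<forall>C\<in>range copy. infinite C \<and> C \<inter> Inl ` univ M = {}) \<and>
      (\<forall>C\<in>range copy. \<forall>C'\<in>range copy. isomorphic_over L N (Inl ` univ M) C C') \<and>
      univ N = Inl ` univ M \<union> \<Union>(range copy)"
    using infinite_copy copy_Inl isomorphic_over_copies UQ_copies by (simp add: image_subset_iff)
  then show ?thesis
    by (intro exI[of _ N] conjI[OF elementary_extension_N] exI[of _ "range copy"])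
qed

end
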